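(* Let $K$ be a finite, connected, pure polygonal $2$-complex in $\mathbb{R}^2$, with a collection of hole polygons $\mathcal{C}^H$ and a singleton $\mathcal{C}^O$ consisting of the outside polygon, satisfying conditions (1)–(4) listed in the context. Let $\hat{K}$ be the Euler transformation of $K$. Let $V,E,F$ denote the sets of vertices, edges, and polygons in $K$, and $\hat V,\hat E,\hat F$ the corresponding sets in $\hat K$. Then $$|\hat V|=2|E|,\qquad |\hat E|=4|E|,\qquad |\hat F|=|V|+|E|+|F|.$$
   Context: A polygonal complex ($2$-complex) $K$ is a collection of polygons in $\mathbb{R}^2$ (not necessarily convex) together with all their faces (edges and vertices), such that the nonempty intersection of any two polygons in $K$ is a face of both. It is pure if every vertex and every edge is a face of some polygon in $K$. Along with $K$ one is given a collection $\mathcal{C}^H$ of polygons capturing the holes, and a singleton $\mathcal{C}^O$ consisting of the polygon capturing the (unbounded) outside; vertices and edges in the intersection of a polygon in $K$ with a polygon in $\mathcal{C}^H$ or $\mathcal{C}^O$ are precisely the boundary cells of $K$. For spaces, $|\cdot|$ denotes underlying space. Conditions: (1) $|K|\cup|\mathcal{C}^H|\cup|\mathcal{C}^O|=\mathbb{R}^2$; (2) polygons in $\mathcal{C}^H$ are pairwise disjoint and disjoint from the outside polygon; (3) any polygon in $K$ and any polygon in $\mathcal{C}^H$ intersect in at most one edge of both; (4) no two adjacent edges of a polygon in $K$ both lie on the outside polygon. Articulation (cut) vertices of $K$ are allowed; they are boundary vertices. Euler transformation $\hat K$ of $K$: every polygon $f\in K\cup\mathcal{C}^H\cup\mathcal{C}^O$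 is duplicated to $\hat f$. If $f\in\mathcal{C}^H\cup\mathcal{C}^O$ then $\hat f=f$; if $f\in K$ then $\hat f$ is a mitered (inward, parallel-edge, as produced via the straight skeleton) offset of $f$, with offset small enough that there are no combinatorial changes (no edge shrinks to a point) and no topological changes ($f$ is not split). Each vertex $v$ (edge $e$) of $f$ has a copy $\hat v$ ($\hat e$) in $\hat f$. The polygons of $\hat K$ are: Class 1: $\hat f$ for each polygon $f\in K$. Class 2: for each edge $e=\{u,v\}\in K$, shared by $f\in K$ and $f'\in K\cup\mathcal{C}^H\cup\mathcal{C}^O$, the $4$-gon $\hat f_e$ with edges $\{\hat u,\hat v\},\{\hat v,\hat v'\},\{\hat u',\hat v'\},\{\hat u,\hat u'\}$, where $\hat u,\hat v$ are the copies of $u,v$ in $\hat f$ and $\hat u',\hat v'$ those in $\hat f'$; the edges $\{\hat u,\hat u'\},\{\hat v,\hat v'\}$ are new. Class 3: for each vertex $v\in K$ lying in polygons $f_1,\dots,f_p$ of $K\cup\mathcal{C}^H\cup\mathcal{C}^O$, the $p$-gon $\hat f_v$ with vertices $\hat v_k$ (the copy of $v$ in $\hat f_k$) and with an edge $\{\hat v_i,\hat v_j\}$ for every pair $f_i,f_j$ that intersect in an edge of $K$ containing $v$. The cells of $\hat K$ are these polygons with their edges and vertices. The hole and outside polygons themselves are not counted among the polygons of $\hat K$.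
   Formalization: At an articulation vertex, a hole or outside polygon passing through it several times contributes one copy of that vertex per visit (though the copies coincide as points); counted as a single copy per polygon, |V̂|=2|E| fails, e.g. for two centre-subdivided triangles glued at a vertex. *)

theory Defs
  imports "HOL-Analysis.Analysis"
begin

text \<open>
  The plane is the type \<open>complex\<close>. A polygon is given by the list of its vertices in the
  cyclic order in which its boundary is traversed with the polygon on the left. Hence a bounded
  polygon and the closure of an unbounded region are treated alike: the former has a
  counterclockwise outer boundary, the latter a clockwise one.
\<close>

type_synonym plgn = "complex list"

definition nxt :: "'a list \<Rightarrow> nat \<Rightarrow> nat" where
  "nxt f i = Suc i mod length f"

definition prv :: "'a list \<Rightarrow> nat \<Rightarrow> nat" where
  "prv f i = (i + length f - 1) mod length f"

definition side :: "plgn \<Rightarrow> nat \<Rightarrow> complex set" where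
  "side f i = {f ! i, f ! nxt f i}"

definition sides :: "plgn \<Rightarrow> complex set set" where
  "sides f = side f ` {..<length f}"

text \<open>An edge is stored as the set of its two end points; as a point set it is the convex hull
  of that set.\<close>

definition trace :: "plgn \<Rightarrow> complex set" where
  "trace f = (\<Union>e\<in>sides f. convex hull e)"

text \<open>The component of the complement of the boundary that lies immediately to the left of the
  midpoint of the side from \<open>f ! 0\<close> to \<open>f ! 1\<close>.\<close>

definition left_face :: "plgn \<Rightarrow> complex set" where
  "left_face f = {z. \<exists>\<epsilon>>0. \<forall>t. 0 < t \<and> t < \<epsilon> \<longrightarrow>
     connected_component (- trace f)
       (midpoint (f ! 0) (f ! 1) + of_real t * \<i> * (f ! 1 - f ! 0)) z}"

definition region :: "plgn \<Rightarrow> complex set" where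
  "region f = closure (left_face f)"

text \<open>The open sector of radius proportional to \<open>\<epsilon>\<close> at the \<open>i\<close>-th vertex that is swept out
  counterclockwise from the outgoing side to the incoming side, i.e. the interior angle.\<close>

definition sector :: "plgn \<Rightarrow> nat \<Rightarrow> real \<Rightarrow> complex set" where
  "sector f i \<epsilon> = {f ! i + of_real r * cis \<theta> * (f ! nxt f i - f ! i) | r \<theta>.
     0 < r \<and> r < \<epsilon> \<and> 0 < \<theta> \<and>
     \<theta> < Arg2pi ((f ! prv f i - f ! i) / (f ! nxt f i - f ! i))}"

text \<open>A vertex may be visited several times. This is needed for hole and outside polygons: at an
  articulation vertex of the complex such a polygon touches itself. The last condition says that
  every corner of the list is a genuine corner of one and the same face; in particular, at a
  repeated vertex the boundary does not cross itself.\<close>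

definition polygon :: "plgn \<Rightarrow> bool" where
  "polygon f \<longleftrightarrow> 3 \<le> length f \<and>
     (\<forall>i<length f. f ! i \<noteq> f ! nxt f i) \<and>
     (\<forall>i<length f. \<forall>j<length f. i \<noteq> j \<longrightarrow>
        convex hull (side f i) \<inter> convex hull (side f j) \<subseteq> side f i \<inter> side f j) \<and>
     (\<forall>i<length f. \<exists>\<epsilon>>0. sector f i \<epsilon> \<subseteq> left_face f)"

definition bounded_polygon :: "plgn \<Rightarrow> bool" where
  "bounded_polygon f \<longleftrightarrow> polygon f \<and> bounded (left_face f)"

definition unbounded_polygon :: "plgn \<Rightarrow> bool" where
  "unbounded_polygon f \<longleftrightarrow> polygon f \<and> \<not> bounded (left_face f)"

definition simple_polygon :: "plgn \<Rightarrow> bool" where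
  "simple_polygon f \<longleftrightarrow> bounded_polygon f \<and> distinct f"

section \<open>Polygonal complexes with holes and outside\<close>

definition polygonal_complex ::
    "complex set \<Rightarrow> complex set set \<Rightarrow> plgn set \<Rightarrow> bool" where
  "polygonal_complex V E F \<longleftrightarrow>
     (\<forall>f\<in>F. simple_polygon f \<and> set f \<subseteq> V \<and> sides f \<subseteq> E) \<and>
     (\<forall>e\<in>E. \<exists>u\<in>V. \<exists>v\<in>V. u \<noteq> v \<and> e = {u, v}) \<and>
     (\<forall>f\<in>F. \<forall>g\<in>F. f \<noteq> g \<longrightarrow>
        region f \<inter> region g = {} \<or>
        (\<exists>x\<in>set f \<inter> set g. region f \<inter> region g = {x}) \<or>
        (\<exists>e\<in>sides f \<inter> sides g. region f \<inter> region g = convex hull e))"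

definition pure_complex ::
    "complex set \<Rightarrow> complex set set \<Rightarrow> plgn set \<Rightarrow> bool" where
  "pure_complex V E F \<longleftrightarrow> (\<forall>v\<in>V. \<exists>f\<in>F. v \<in> set f) \<and> (\<forall>e\<in>E. \<exists>f\<in>F. e \<in> sides f)"

definition underlying_space ::
    "complex set \<Rightarrow> complex set set \<Rightarrow> plgn set \<Rightarrow> complex set" where
  "underlying_space V E F = V \<union> (\<Union>e\<in>E. convex hull e) \<union> (\<Union>f\<in>F. region f)"

text \<open>The hole polygons \<open>CH\<close> and the outside polygon in \<open>CO\<close> meet polygons of the complex exactly
  in common edges and vertices, and their edges and vertices are precisely the boundary cells of
  the complex, i.e. the cells contained in the frontier of the underlying space.\<close>

definition holes_and_outside ::
    "complex set \<Rightarrow> complex set set \<Rightarrow> plgn set \<Rightarrow> plgn set \<Rightarrow> plgn set \<Rightarrow> bool" where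
  "holes_and_outside V E F CH CO \<longleftrightarrow>
     (\<forall>h\<in>CH. bounded_polygon h) \<and>
     is_singleton CO \<and> (\<forall>q\<in>CO. unbounded_polygon q) \<and>
     (\<forall>f\<in>F. \<forall>c\<in>CH \<union> CO. region f \<inter> region c =
        (set f \<inter> set c) \<union> (\<Union>e\<in>sides f \<inter> sides c. convex hull e)) \<and>
     (\<Union>c\<in>CH \<union> CO. set c) = {v\<in>V. v \<in> frontier (underlying_space V E F)} \<and>
     (\<Union>c\<in>CH \<union> CO. sides c) = {e\<in>E. convex hull e \<subseteq> frontier (underlying_space V E F)}"

section \<open>Mitered offsets\<close>

definition inward_normal :: "plgn \<Rightarrow> nat \<Rightarrow> complex" where
  "inward_normal f i = \<i> * sgn (f ! nxt f i - f ! i)"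

text \<open>The velocity of the \<open>i\<close>-th vertex when all sides move inward in parallel with unit speed:
  it has inner product 1 with the inward unit normals of both sides at that vertex (and it is
  their common normal if these two sides are collinear).\<close>

definition miter :: "plgn \<Rightarrow> nat \<Rightarrow> complex" where
  "miter f i =
     (let m = inward_normal f (prv f i); n = inward_normal f i in (m + n) /\<^sub>R (1 + m \<bullet> n))"

definition offset :: "real \<Rightarrow> plgn \<Rightarrow> plgn" where
  "offset s f = map (\<lambda>i. f ! i + s *\<^sub>R miter f i) [0..<length f]"

text \<open>Up to distance \<open>d\<close> the shrinking polygon undergoes no event: no side collapses and the
  polygon is not split.\<close>

definition small_offset :: "real \<Rightarrow> plgn \<Rightarrow> bool" where
  "small_offset d f \<longleftrightarrow> 0 < d \<and>
     (\<forall>s. 0 < s \<and> s \<le> d \<longrightarrow>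
        simple_polygon (offset s f) \<and> region (offset s f) \<subseteq> left_face f)"

section \<open>The Euler transformation\<close>

text \<open>A vertex of the transformed complex is a point together with a multiplicity index. In a
  polygon without repeated vertices all indices are 0, so that its vertices are just points. The
  index separates the several copies of an articulation vertex in a hole or outside polygon that
  passes through it more than once.\<close>

type_synonym hvert = "complex \<times> nat"

text \<open>A polygon of the transformed complex is given by its vertices and its edges.\<close>

type_synonym hplgn = "hvert set \<times> hvert set set"

definition corner :: "plgn \<Rightarrow> nat \<Rightarrow> hvert" where
  "corner g i = (g ! i, card {j. j < i \<and> g ! j = g ! i})"

text \<open>Parameters: the polygons \<open>F\<close> of the complex and their offset distances \<open>d\<close>. Polygons
  outside \<open>F\<close> (holes and outside) are left unchanged.\<close>

definition hat :: "plgn set \<Rightarrow> (plgn \<Rightarrow> real) \<Rightarrow> plgn \<Rightarrow> plgn" where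
  "hat F d f = (if f \<in> F then offset (d f) f else f)"

text \<open>The copy in \<open>hat F d f\<close> of the end point \<open>x\<close> of the \<open>i\<close>-th side of \<open>f\<close>.\<close>

definition copy :: "plgn set \<Rightarrow> (plgn \<Rightarrow> real) \<Rightarrow> plgn \<Rightarrow> nat \<Rightarrow> complex \<Rightarrow> hvert" where
  "copy F d f i x = corner (hat F d f) (if x = f ! i then i else nxt f i)"

definition class1 :: "plgn set \<Rightarrow> (plgn \<Rightarrow> real) \<Rightarrow> hplgn set" where
  "class1 F d =
     {({corner (hat F d f) i | i. i < length f},
       {{corner (hat F d f) i, corner (hat F d f) (nxt f i)} | i. i < length f}) | f. f \<in> F}"

definition class2 ::
    "complex set set \<Rightarrow> plgn set \<Rightarrow> plgn set \<Rightarrow> plgn set \<Rightarrow> (plgn \<Rightarrow> real) \<Rightarrow> hplgn set" where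
  "class2 E F CH CO d =
     {({copy F d f i u, copy F d f i v, copy F d f' j v, copy F d f' j u},
       {{copy F d f i u, copy F d f i v}, {copy F d f i v, copy F d f' j v},
        {copy F d f' j u, copy F d f' j v}, {copy F d f i u, copy F d f' j u}}) | u v f f' i j.
       {u, v} \<in> E \<and> f \<in> F \<and> f' \<in> F \<union> CH \<union> CO \<and> f \<noteq> f' \<and>
       i < length f \<and> j < length f' \<and> side f i = {u, v} \<and> side f' j = {u, v}}"

definition class3 ::
    "complex set \<Rightarrow> complex set set \<Rightarrow> plgn set \<Rightarrow> plgn set \<Rightarrow> plgn set \<Rightarrow> (plgn \<Rightarrow> real) \<Rightarrow>
      hplgn set" where
  "class3 V E F CH CO d =
     {({corner (hat F d f) i | f i. f \<in> F \<union> CH \<union> CO \<and> i < length f \<and> f ! i = v},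
       {{copy F d f i v, copy F d f' j v} | f f' i j.
          f \<in> F \<union> CH \<union> CO \<and> f' \<in> F \<union> CH \<union> CO \<and> f \<noteq> f' \<and> i < length f \<and> j < length f' \<and>
          side f i = side f' j \<and> side f i \<in> E \<and> v \<in> side f i}) | v. v \<in> V}"

definition euler_polygons ::
    "complex set \<Rightarrow> complex set set \<Rightarrow> plgn set \<Rightarrow> plgn set \<Rightarrow> plgn set \<Rightarrow> (plgn \<Rightarrow> real) \<Rightarrow>
      hplgn set" where
  "euler_polygons V E F CH CO d =
     class1 F d \<union> class2 E F CH CO d \<union> class3 V E F CH CO d"

definition euler_edges ::
    "complex set \<Rightarrow> complex set set \<Rightarrow> plgn set \<Rightarrow> plgn set \<Rightarrow> plgn set \<Rightarrow> (plgn \<Rightarrow> real) \<Rightarrow>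
      hvert set set" where
  "euler_edges V E F CH CO d = (\<Union>p\<in>euler_polygons V E F CH CO d. snd p)"

definition euler_verts ::
    "complex set \<Rightarrow> complex set set \<Rightarrow> plgn set \<Rightarrow> plgn set \<Rightarrow> plgn set \<Rightarrow> (plgn \<Rightarrow> real) \<Rightarrow>
      hvert set" where
  "euler_verts V E F CH CO d = (\<Union>p\<in>euler_polygons V E F CH CO d. fst p)"

end

theory Submission
  imports Defs
begin

text \<open>
  Call a pair of a polygon (of the complex, a hole, or the outside) and one of its sides a corner;
  it stands for the side and for its starting point. The two polygons at an edge traverse it in
  opposite directions, so corners are paired by a fixed-point-free involution \<open>mate\<close> and there are
  \<open>2|E|\<close> of them. That an edge has at most two polygons holds because polygons traversing it in the
  same direction overlap to its left; that it has two follows from the Jordan curve theorem and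
  condition (1).

  Every vertex of the transformed complex is the copy of exactly one corner. Every edge is either
  the copy of a side, which determines one corner, or joins the two copies of an end point of an
  edge; the latter is attached to the corner whose side starts at that end point. Conditions (3)
  and (4) make the second correspondence injective. The three classes of polygons are then indexed
  by \<open>F\<close>, \<open>E\<close> and \<open>V\<close>, and are told apart by the kinds of their edges.
\<close>

section \<open>Cyclic indices and sides\<close>

lemma nxt_less: "i < length f \<Longrightarrow> nxt f i < length f"
  by (auto simp: nxt_def intro!: mod_less_divisor)

lemma prv_less: "i < length f \<Longrightarrow> prv f i < length f"
  by (auto simp: prv_def intro!: mod_less_divisor)

lemma nxt_eq: "i < length f \<Longrightarrow> nxt f i = (if Suc i = length f then 0 else Suc i)"
  by (auto simp: nxt_def)

lemma prv_eq: "i < length f \<Longrightarrow> prv f i = (if i = 0 then length f - 1 else i - 1)"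
proof -
  assume i: "i < length f"
  show ?thesis
  proof (cases i)
    case 0
    then show ?thesis using i by (simp add: prv_def)
  next
    case (Suc k)
    then have "i + length f - 1 = k + length f" by simp
    then show ?thesis using i Suc by (simp add: prv_def)
  qed
qed

lemma nxt_prv: "i < length f \<Longrightarrow> nxt f (prv f i) = i"
  using prv_less[of i f] by (auto simp: nxt_eq prv_eq split: if_splits)

lemma nxt_neq: "i < length f \<Longrightarrow> 2 \<le> length f \<Longrightarrow> nxt f i \<noteq> i"
  by (auto simp: nxt_eq)

lemma nxt_nxt_neq: "i < length f \<Longrightarrow> 3 \<le> length f \<Longrightarrow> nxt f (nxt f i) \<noteq> i"
  using nxt_less[of i f] by (auto simp: nxt_eq split: if_splits)

lemma prv_neq: "i < length f \<Longrightarrow> 2 \<le> length f \<Longrightarrow> prv f i \<noteq> i"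
  by (auto simp: prv_eq)

text \<open>The index of \<open>corner\<close> counts earlier visits to the same point. If
  \<open>i < j\<close> visit the same point, then \<open>i\<close> itself is counted for
  \<open>j\<close> but not for \<open>i\<close>, so the index strictly grows.\<close>

lemma corner_inj:
  assumes "corner g i = corner g j"
  shows "i = j"
proof -
  have less: False if "i < j" and eq: "corner g i = corner g j" for i j
  proof -
    have "{k. k < i \<and> g ! k = g ! i} \<subset> {k. k < j \<and> g ! k = g ! j}"
      using that by (auto simp: corner_def)
    then have "card {k. k < i \<and> g ! k = g ! i} < card {k. k < j \<and> g ! k = g ! j}"
      by (intro psubset_card_mono) auto
    then show False using eq by (simp add: corner_def)
  qed
  show ?thesis using less[of i j] less[of j i] assms by (metis linorder_neqE_nat)
qed

section \<open>Polygons\<close>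

lemma trace_eq: "trace f = (\<Union>i<length f. convex hull (side f i))"
  by (auto simp: trace_def sides_def)

lemma nth_in_side: "f ! i \<in> side f i" "f ! nxt f i \<in> side f i"
  by (auto simp: side_def)

lemma sides_subset_set: "e \<in> sides f \<Longrightarrow> e \<subseteq> set f"
  by (auto simp: sides_def side_def nxt_less)

lemma side_in_sides: "i < length f \<Longrightarrow> side f i \<in> sides f"
  by (auto simp: sides_def)

lemma hull_side: "convex hull (side f i) = closed_segment (f ! i) (f ! nxt f i)"
  by (simp add: side_def segment_convex_hull)

lemma set_subset_trace: "set f \<subseteq> trace f"
  by (force simp: in_set_conv_nth trace_eq intro: hull_inc nth_in_side)

lemma closure_finite_UN: "finite A \<Longrightarrow> closure (\<Union>x\<in>A. B x) = (\<Union>x\<in>A. closure (B x))"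
  by (induction A rule: finite_induct) auto

lemma half_min:
  fixes a b :: real
  assumes "0 < a" "0 < b"
  shows "0 < min a b / 2" "min a b / 2 < a" "min a b / 2 < b"
  using assms by (auto simp: min_def)

lemma interior_point_of_segment:
  fixes u v :: complex
  assumes "u \<noteq> v" "0 < r" "r < 1"
  shows "u + of_real r * (v - u) \<in> closed_segment u v" (is ?P)
    and "u + of_real r * (v - u) \<notin> {u, v}"
proof -
  have "u + of_real r * (v - u) = (1 - r) *\<^sub>R u + r *\<^sub>R v"
    by (simp add: algebra_simps scaleR_conv_of_real)
  then show ?P using assms unfolding in_segment by (intro exI[of _ r]) auto
  have "of_real r * (v - u) \<noteq> v - u" using assms by (auto simp: mult_cancel_right2)
  then show "u + of_real r * (v - u) \<notin> {u, v}"
    using assms by (auto simp: algebra_simps)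
qed

lemma polygon_length: "polygon f \<Longrightarrow> 3 \<le> length f"
  by (simp add: polygon_def)

lemma polygon_side_neq: "polygon f \<Longrightarrow> i < length f \<Longrightarrow> f ! i \<noteq> f ! nxt f i"
  by (simp add: polygon_def)

lemma polygon_hulls:
  "polygon f \<Longrightarrow> i < length f \<Longrightarrow> j < length f \<Longrightarrow> i \<noteq> j \<Longrightarrow>
    convex hull (side f i) \<inter> convex hull (side f j) \<subseteq> side f i \<inter> side f j"
  unfolding polygon_def by blast

text \<open>Distinct sides meet only in common end points, and for \<open>0 < r < 1\<close> the
  point is not an end point.\<close>

lemma polygon_point_on_side:
  assumes "polygon f" "i < length f" "j < length f" "0 < r" "r < 1"
    and "f ! i + of_real r * (f ! nxt f i - f ! i) \<in> convex hull (side f j)"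
  shows "j = i"
proof (rule ccontr)
  assume "j \<noteq> i"
  then have "f ! i + of_real r * (f ! nxt f i - f ! i) \<in> side f i"
    using polygon_hulls[OF assms(1,2,3)] assms(6)
      interior_point_of_segment[OF polygon_side_neq[OF assms(1,2)] assms(4,5)]
    by (auto simp: hull_side)
  then show False
    using interior_point_of_segment(2)[OF polygon_side_neq[OF assms(1,2)] assms(4,5)]
    by (simp add: side_def)
qed

text \<open>The midpoint of a side lies on no other side. Hence no polygon runs along an edge twice,
  not even in opposite directions.\<close>

lemma polygon_side_inj: "polygon f \<Longrightarrow> inj_on (side f) {..<length f}"
proof (rule inj_onI)
  fix i j assume f: "polygon f" and i: "i \<in> {..<length f}" "j \<in> {..<length f}"
    and eq: "side f i = side f j"
  have "f ! i + of_real (1/2) * (f ! nxt f i - f ! i) \<in> convex hull (side f i)"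
    using interior_point_of_segment(1)[OF polygon_side_neq[OF f, of i], of "1/2"] i
    by (simp add: hull_side)
  then show "i = j"
    using polygon_point_on_side[OF f, of i j "1/2"] i eq by auto
qed

lemma polygon_vertex_on_side:
  assumes "polygon f" "x \<in> set f" "k < length f" "x \<in> convex hull (side f k)"
  shows "x \<in> side f k"
proof -
  obtain l where l: "l < length f" "x = f ! l" using assms(2) by (auto simp: in_set_conv_nth)
  show ?thesis
  proof (cases "l = k")
    case True then show ?thesis using l by (simp add: side_def)
  next
    case False
    then show ?thesis
      using polygon_hulls[OF assms(1) l(1) assms(3)] assms(4) l nth_in_side(1)[of f l]
      by (auto dest: hull_inc)
  qed
qed

text \<open>At angle 0 the outgoing and the incoming side would leave the corner in the same
  direction and overlap beyond their common end point.\<close>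

lemma polygon_angle_pos:
  assumes f: "polygon f" and i: "i < length f"
  shows "0 < Arg2pi ((f ! prv f i - f ! i) / (f ! nxt f i - f ! i))" (is "0 < Arg2pi ?q")
proof (rule ccontr)
  let ?u = "f ! i" let ?v = "f ! nxt f i" let ?w = "f ! prv f i"
  assume "\<not> 0 < Arg2pi ?q"
  then have "Arg2pi ?q = 0" using Arg2pi_ge_0[of ?q] by linarith
  then have re: "?q \<in> \<real>" "0 \<le> Re ?q" by (auto simp: Arg2pi_eq_0)
  have uv: "?u \<noteq> ?v" using polygon_side_neq[OF f i] .
  have wu: "?w \<noteq> ?u" using polygon_side_neq[OF f prv_less[OF i]] nxt_prv[OF i] by simp
  define c where "c = Re ?q"
  have q: "?q = of_real c" using re by (simp add: c_def)
  then have w: "?w = ?u + of_real c * (?v - ?u)" using uv by (simp add: field_simps)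
  have "c \<noteq> 0" using w wu by auto
  then have c: "0 < c" using re(2) by (simp add: c_def)
  \<comment> \<open>Below both 1 and \<open>c\<close>, so that the point at parameter
    \<open>s\<close> lies strictly inside the outgoing side and, at parameter \<open>s / c\<close>,
    strictly inside the incoming one.\<close>
  define s where "s = min c 1 / 2"
  have s: "0 < s" "s < 1" "s < c" using c by (auto simp: s_def)
  have "?u + of_real s * (?v - ?u) = ?u + of_real (s / c) * (?w - ?u)"
    unfolding w using c by simp
  also have "\<dots> \<in> closed_segment ?u ?w"
    using interior_point_of_segment(1)[of ?u ?w "s / c"] wu s c by (auto simp: field_simps)
  also have "\<dots> = convex hull (side f (prv f i))"
    by (simp add: hull_side nxt_prv[OF i] closed_segment_commute)
  finally have "prv f i = i"
    using polygon_point_on_side[OF f i prv_less[OF i]] s by blast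
  then show False using prv_neq[OF i] polygon_length[OF f] by linarith
qed

text \<open>A single bound for radius and angle replaces the interior angle, so that sectors of
  different polygons can be compared.\<close>

lemma polygon_sector:
  assumes f: "polygon f" and i: "i < length f"
  obtains \<epsilon> where "0 < \<epsilon>" and "\<And>r \<theta>. 0 < r \<Longrightarrow> r < \<epsilon> \<Longrightarrow> 0 < \<theta> \<Longrightarrow> \<theta> < \<epsilon> \<Longrightarrow>
    f ! i + of_real r * cis \<theta> * (f ! nxt f i - f ! i) \<in> left_face f"
proof -
  obtain \<epsilon> where \<epsilon>: "\<epsilon> > 0" "sector f i \<epsilon> \<subseteq> left_face f"
    using f i unfolding polygon_def by blast
  show ?thesis
    by (rule that[of "min \<epsilon> (Arg2pi ((f ! prv f i - f ! i) / (f ! nxt f i - f ! i)))"])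
      (use \<epsilon> polygon_angle_pos[OF f i] in \<open>auto simp: sector_def\<close>)
qed

section \<open>The face to the left of a polygon\<close>

lemma left_face_trace: "left_face f \<inter> trace f = {}"
proof -
  have False if z: "z \<in> left_face f" "z \<in> trace f" for z
  proof -
    obtain \<epsilon> where "\<epsilon> > 0" and \<epsilon>: "\<And>t. 0 < t \<Longrightarrow> t < \<epsilon> \<Longrightarrow> connected_component (- trace f)
       (midpoint (f ! 0) (f ! 1) + of_real t * \<i> * (f ! 1 - f ! 0)) z"
      using z(1) unfolding left_face_def by blast
    then have "z \<in> - trace f"
      using \<epsilon>[of "\<epsilon> / 2"] by (auto dest: connected_component_in)
    then show False using z(2) by simp
  qed
  then show ?thesis by blast
qed

text \<open>A base point close enough to the first side is connected to both \<open>x\<close> and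
  \<open>y\<close>.\<close>

lemma left_face_connected:
  assumes "x \<in> left_face f" "y \<in> left_face f"
  shows "connected_component (- trace f) x y"
proof -
  let ?p = "\<lambda>t::real. midpoint (f ! 0) (f ! 1) + of_real t * \<i> * (f ! 1 - f ! 0)"
  obtain a where a: "a > 0" "\<And>t. 0 < t \<Longrightarrow> t < a \<Longrightarrow> connected_component (- trace f) (?p t) x"
    using assms(1) unfolding left_face_def by blast
  obtain b where b: "b > 0" "\<And>t. 0 < t \<Longrightarrow> t < b \<Longrightarrow> connected_component (- trace f) (?p t) y"
    using assms(2) unfolding left_face_def by blast
  let ?t = "min a b / 2"
  have "connected_component (- trace f) (?p ?t) x" "connected_component (- trace f) (?p ?t) y"
    by (rule a(2) b(2); use a(1) b(1) in simp)+
  then show ?thesis by (metis connected_component_sym connected_component_trans)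
qed

lemma left_face_component:
  assumes "x \<in> left_face f" "connected_component (- trace f) x y"
  shows "y \<in> left_face f"
  using assms unfolding left_face_def by (blast intro: connected_component_trans)

lemma left_face_absorbs:
  assumes "connected S" "S \<inter> trace f = {}" "x \<in> S" "x \<in> left_face f"
  shows "S \<subseteq> left_face f"
proof
  fix y assume "y \<in> S"
  then have "connected_component (- trace f) x y"
    using assms unfolding connected_component_def by blast
  then show "y \<in> left_face f" using assms left_face_component by blast
qed

lemma left_face_subset_region: "left_face f \<subseteq> region f"
  by (simp add: region_def closure_subset)

text \<open>The sector at a corner consists of points of the left face and accumulates at the
  corner.\<close>

lemma vertex_in_region:
  assumes f: "polygon f" and "x \<in> set f"
  shows "x \<in> region f"
proof -
  obtain i where i: "i < length f" "x = f ! i" using assms(2) by (auto simp: in_set_conv_nth)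
  obtain \<epsilon> where \<epsilon>: "0 < \<epsilon>" "\<And>r \<theta>. 0 < r \<Longrightarrow> r < \<epsilon> \<Longrightarrow> 0 < \<theta> \<Longrightarrow> \<theta> < \<epsilon> \<Longrightarrow>
    f ! i + of_real r * cis \<theta> * (f ! nxt f i - f ! i) \<in> left_face f"
    using polygon_sector[OF f i(1)] by blast
  have "\<exists>y\<in>left_face f. dist y (f ! i) < \<delta>" if \<delta>: "0 < \<delta>" for \<delta>
  proof -
    let ?w = "f ! nxt f i - f ! i"
    have w: "0 < norm ?w" using polygon_side_neq[OF f i(1)] by simp
    define r where "r = min \<epsilon> (\<delta> / norm ?w) / 2"
    have r: "0 < r" "r < \<epsilon>" "r < \<delta> / norm ?w"
      using half_min[of \<epsilon> "\<delta> / norm ?w"] \<epsilon>(1) \<delta> w unfolding r_def by auto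
    have "dist (f ! i + of_real r * cis (\<epsilon>/2) * ?w) (f ! i) < \<delta>"
      using r w by (simp add: dist_norm norm_mult pos_less_divide_eq)
    then show ?thesis using \<epsilon> r by (intro bexI[OF _ \<epsilon>(2)[of r "\<epsilon>/2"]]) auto
  qed
  then show ?thesis by (simp add: region_def closure_approachable i)
qed

lemma set_subset_region: "polygon f \<Longrightarrow> set f \<subseteq> region f"
  by (simp add: subsetI vertex_in_region)

text \<open>Both sectors are thin wedges to the left of the same directed segment with the same
  apex, so the smaller one lies in both left faces.\<close>

lemma common_directed_side:
  assumes f: "polygon f" "i < length f" and g: "polygon g" "j < length g"
    and eq: "f ! i = g ! j" "f ! nxt f i = g ! nxt g j"
  shows "left_face f \<inter> left_face g \<noteq> {}"
proof -
  obtain a where a: "0 < a" "\<And>r \<theta>. 0 < r \<Longrightarrow> r < a \<Longrightarrow> 0 < \<theta> \<Longrightarrow> \<theta> < a \<Longrightarrow>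
    f ! i + of_real r * cis \<theta> * (f ! nxt f i - f ! i) \<in> left_face f"
    using polygon_sector[OF f] by blast
  obtain b where b: "0 < b" "\<And>r \<theta>. 0 < r \<Longrightarrow> r < b \<Longrightarrow> 0 < \<theta> \<Longrightarrow> \<theta> < b \<Longrightarrow>
    g ! j + of_real r * cis \<theta> * (g ! nxt g j - g ! j) \<in> left_face g"
    using polygon_sector[OF g] by blast
  show ?thesis
    using a(2)[of "min a b / 2" "min a b / 2"] b(2)[of "min a b / 2" "min a b / 2"]
      half_min[OF a(1) b(1)] unfolding eq by blast
qed

section \<open>The two sides of an edge of a simple polygon\<close>

text \<open>The path runs through the sides \<open>0\<close> to \<open>n\<close> and leaves the
  polygon open, so that it is an arc until the last side closes it to a Jordan curve.\<close>

fun chain :: "plgn \<Rightarrow> nat \<Rightarrow> real \<Rightarrow> complex" where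
  "chain f 0 = linepath (f ! 0) (f ! 1)"
| "chain f (Suc n) = chain f n +++ linepath (f ! Suc n) (f ! Suc (Suc n))"

lemma pathstart_chain [simp]: "pathstart (chain f n) = f ! 0"
  by (induction n) auto

lemma pathfinish_chain [simp]: "pathfinish (chain f n) = f ! Suc n"
  by (cases n) auto

lemma path_image_chain: "path_image (chain f n) = (\<Union>k\<le>n. closed_segment (f ! k) (f ! Suc k))"
  by (induction n) (auto simp: path_image_join atMost_Suc)

text \<open>Induction on \<open>n\<close>: the new segment meets the earlier ones only at its start,
  because its other end is a vertex not visited before.\<close>

lemma arc_chain:
  assumes f: "polygon f" "distinct f" and n: "Suc n < length f"
  shows "arc (chain f n)"
  using n
proof (induction n)
  case 0
  then have "f ! 0 \<noteq> f ! 1" using f(2) by (subst nth_eq_iff_index_eq) auto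
  then show ?case by (simp add: arc_linepath)
next
  case (Suc n)
  have "path_image (chain f n) \<inter> closed_segment (f ! Suc n) (f ! Suc (Suc n)) \<subseteq> {f ! Suc n}"
  proof -
    have "closed_segment (f ! k) (f ! Suc k) \<inter> closed_segment (f ! Suc n) (f ! Suc (Suc n))
        \<subseteq> {f ! Suc n}" if "k \<le> n" for k
    proof -
      have "nxt f k = Suc k" "nxt f (Suc n) = Suc (Suc n)"
        using that Suc.prems by (auto simp: nxt_eq)
      then have "closed_segment (f ! k) (f ! Suc k) \<inter> closed_segment (f ! Suc n) (f ! Suc (Suc n))
          \<subseteq> {f ! k, f ! Suc k} \<inter> {f ! Suc n, f ! Suc (Suc n)}"
        using that Suc.prems polygon_hulls[OF f(1), of k "Suc n"]
        unfolding hull_side by (simp add: side_def)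
      moreover have "f ! Suc (Suc n) \<noteq> f ! k" "f ! Suc (Suc n) \<noteq> f ! Suc k"
        using that Suc.prems f(2) by (auto simp: nth_eq_iff_index_eq)
      ultimately show ?thesis by auto
    qed
    then show ?thesis unfolding path_image_chain by blast
  qed
  moreover have "f ! Suc n \<noteq> f ! Suc (Suc n)"
    using Suc.prems f(2) by (simp add: nth_eq_iff_index_eq)
  ultimately show ?case using Suc by (auto intro!: arc_join)
qed

lemma simple_polygon_curve:
  assumes f: "polygon f" "distinct f"
  obtains c where "simple_path c" "pathfinish c = pathstart c" "path_image c = trace f"
proof -
  obtain n where n: "length f = Suc (Suc n)" "0 < n"
    using polygon_length[OF f(1)] by (metis Suc_1 Suc_le_D Suc_le_mono
        numeral_3_eq_3 zero_less_Suc)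
  define c where "c = chain f n +++ linepath (f ! Suc n) (f ! 0)"
  have last: "closed_segment (f ! Suc n) (f ! 0) = convex hull (side f (Suc n))"
    using n by (simp add: hull_side nxt_eq)
  have seg: "closed_segment (f ! k) (f ! Suc k) = convex hull (side f k)" if "k \<le> n" for k
    using n that by (simp add: hull_side nxt_eq)
  have im: "path_image (chain f n) = (\<Union>k\<le>n. convex hull (side f k))"
    using seg by (simp add: path_image_chain)
  have "path_image (chain f n) \<inter> closed_segment (f ! Suc n) (f ! 0) \<subseteq> {f ! 0, f ! Suc n}"
  proof -
    have "convex hull (side f k) \<inter> convex hull (side f (Suc n)) \<subseteq> side f (Suc n)" if "k \<le> n" for k
      using polygon_hulls[OF f(1), of k "Suc n"] n that by auto
    moreover have "side f (Suc n) = {f ! 0, f ! Suc n}"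
      using n by (auto simp: side_def nxt_eq)
    ultimately show ?thesis unfolding im last by blast
  qed
  moreover have "f ! Suc n \<noteq> f ! 0" using n f(2) by (simp add: nth_eq_iff_index_eq)
  ultimately have "simple_path c"
    unfolding c_def using arc_chain[OF f, of n] n by (intro simple_path_join_loop) auto
  moreover have "path_image c = trace f"
    by (auto simp: c_def path_image_join im last trace_eq n lessThan_Suc_atMost atMost_Suc)
  ultimately show ?thesis using that[of c] by (simp add: c_def)
qed

text \<open>In the coordinate \<open>(z - m) / w\<close> a side through \<open>m\<close> with
  direction \<open>w\<close> becomes part of the real axis, so left and right are the signs of the
  imaginary part. The radius is measured in units of \<open>cmod w\<close>.\<close>

definition half_disc :: "bool \<Rightarrow> complex \<Rightarrow> complex \<Rightarrow> real \<Rightarrow> complex set" where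
  "half_disc left m w \<rho> =
     {z. cmod ((z - m) / w) < \<rho> \<and> (if left then 0 < Im ((z - m) / w) else Im ((z - m) / w) < 0)}"

text \<open>As an affine image of a convex set the half disc is connected.\<close>

lemma half_disc_image:
  assumes "w \<noteq> 0"
  shows "half_disc left m w \<rho> =
    (\<lambda>q. m + w * q) ` (ball 0 \<rho> \<inter> (if left then {q. 0 < Im q} else {q. Im q < 0}))"
    (is "_ = ?g ` ?S")
proof
  show "half_disc left m w \<rho> \<subseteq> ?g ` ?S"
  proof
    fix z assume "z \<in> half_disc left m w \<rho>"
    then have "(z - m) / w \<in> ?S" by (auto simp: half_disc_def split: if_splits)
    moreover have "z = ?g ((z - m) / w)" using assms by simp
    ultimately show "z \<in> ?g ` ?S" by blast
  qed
  show "?g ` ?S \<subseteq> half_disc left m w \<rho>"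
    using assms by (auto simp: half_disc_def)
qed

lemma connected_half_disc: "w \<noteq> 0 \<Longrightarrow> connected (half_disc left m w \<rho>)"
  unfolding half_disc_image
  by (intro connected_continuous_image continuous_intros convex_connected convex_Int convex_ball)
    (simp add: convex_halfspace_Im_gt convex_halfspace_Im_lt)

lemma open_half_disc: "w \<noteq> 0 \<Longrightarrow> open (half_disc left m w \<rho>)"
  unfolding half_disc_def
  by (cases left) (auto intro!: open_Collect_conj open_Collect_less continuous_intros)

lemma centre_in_closure_half_disc:
  assumes w: "w \<noteq> 0" and \<rho>: "0 < \<rho>"
  shows "m \<in> closure (half_disc left m w \<rho>)"
  unfolding closure_approachable
proof (intro allI impI)
  fix \<delta> :: real assume \<delta>: "0 < \<delta>"
  define t where "t = min \<rho> (\<delta> / cmod w) / 2"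
  have t: "0 < t" "t < \<rho>" "t < \<delta> / cmod w"
    using half_min[of \<rho> "\<delta> / cmod w"] assms \<delta> unfolding t_def by auto
  define z where "z = m + w * (of_real (if left then t else - t) * \<i>)"
  have z: "(z - m) / w = of_real (if left then t else - t) * \<i>" using w by (simp add: z_def)
  have "z \<in> half_disc left m w \<rho>" unfolding half_disc_def mem_Collect_eq z using t by (auto simp: norm_mult)
  moreover have "dist z m < \<delta>"
    using t w by (auto simp: dist_norm z_def norm_mult field_simps)
  ultimately show "\<exists>y\<in>half_disc left m w \<rho>. dist y m < \<delta>" by blast
qed

text \<open>Near a suitable point \<open>m\<close> of the side the boundary is only that side, so
  each half disc at \<open>m\<close> avoids it. The left one meets the sector and hence lies in the
  left face. If the right one met the left face too, the left face would contain points both inside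
  and outside the Jordan curve although it is connected.\<close>

lemma simple_polygon_side:
  assumes f: "polygon f" "distinct f" and i: "i < length f"
  obtains r \<rho> where "0 < r" "r < 1" "0 < \<rho>"
    and "half_disc True (f ! i + of_real r * (f ! nxt f i - f ! i)) (f ! nxt f i - f ! i) \<rho> \<subseteq> left_face f"
    and "half_disc False (f ! i + of_real r * (f ! nxt f i - f ! i)) (f ! nxt f i - f ! i) \<rho>
           \<inter> region f = {}"
proof -
  define u where "u = f ! i"
  define w where "w = f ! nxt f i - f ! i"
  have w: "w \<noteq> 0" using polygon_side_neq[OF f(1) i] by (simp add: w_def)
  obtain \<epsilon> where \<epsilon>: "0 < \<epsilon>" "\<And>r \<theta>. 0 < r \<Longrightarrow> r < \<epsilon> \<Longrightarrow> 0 < \<theta> \<Longrightarrow> \<theta> < \<epsilon> \<Longrightarrow>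
    u + of_real r * cis \<theta> * w \<in> left_face f"
    using polygon_sector[OF f(1) i] unfolding u_def w_def by blast
  \<comment> \<open>With \<open>r < 1\<close> the point \<open>m\<close> is interior to the side;
    with \<open>r < \<epsilon>\<close> it is within reach of the sector at \<open>u\<close>.\<close>
  define r where "r = min \<epsilon> 1 / 2"
  have r: "0 < r" "r < 1" "r < \<epsilon>" using \<epsilon>(1) by (auto simp: r_def)
  define m where "m = u + of_real r * w"
  have m_side: "j = i" if "j < length f" "m \<in> convex hull (side f j)" for j
    using polygon_point_on_side[OF f(1) i] r that by (auto simp: m_def u_def w_def)
  define K where "K = (\<Union>j\<in>{..<length f} - {i}. convex hull (side f j))"
  have "closed K" unfolding K_def hull_side by (intro closed_UN) auto
  moreover have "m \<notin> K" using m_side by (auto simp: K_def)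
  ultimately obtain \<sigma> where \<sigma>: "0 < \<sigma>" "ball m \<sigma> \<subseteq> - K"
    using open_contains_ball[of "- K"] by (auto simp: open_Compl)
  \<comment> \<open>The first bound keeps the disc away from the other sides, the other two keep its
    diameter along \<open>w\<close> inside the side.\<close>
  define \<rho> where "\<rho> = min (\<sigma> / cmod w) (min r (1 - r))"
  have \<rho>: "0 < \<rho>" using \<sigma> w r by (simp add: \<rho>_def)
  have on_trace: "z \<in> trace f \<longleftrightarrow> Im ((z - m) / w) = 0" if z: "cmod ((z - m) / w) < \<rho>" for z
  proof
    have zK: "z \<notin> K"
    proof -
      have "cmod (z - m) < \<sigma>" using z w by (simp add: \<rho>_def norm_divide field_simps)
      then have "z \<in> ball m \<sigma>" by (simp add: dist_norm norm_minus_commute)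
      then show ?thesis using \<sigma> by blast
    qed
    {
      assume "z \<in> trace f"
      then have "z \<in> convex hull (side f i)" using zK by (auto simp: trace_eq K_def)
      then obtain a where "z = (1 - a) *\<^sub>R u + a *\<^sub>R (u + w)"
        by (auto simp: hull_side in_segment u_def w_def)
      then have "z - m = of_real (a - r) * w"
        by (simp add: m_def scaleR_conv_of_real algebra_simps)
      then show "Im ((z - m) / w) = 0" using w by simp
    next
      define x where "x = Re ((z - m) / w)"
      assume "Im ((z - m) / w) = 0"
      then have q: "(z - m) / w = of_real x" by (simp add: x_def complex_eq_iff)
      then have "\<bar>x\<bar> < \<rho>" using z by simp
      then have x: "0 < r + x" "r + x < 1" by (auto simp: \<rho>_def)
      have "z = u + of_real (r + x) * w" using q w by (simp add: m_def field_simps)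
      also have "\<dots> \<in> closed_segment u (u + w)"
        using interior_point_of_segment(1)[of u "u + w" "r + x"] x w by simp
      finally show "z \<in> trace f" using i by (auto simp: trace_eq hull_side u_def w_def)
    }
  qed
  let ?L = "half_disc True m w \<rho>" let ?R = "half_disc False m w \<rho>"
  have L_trace: "?L \<inter> trace f = {}" and R_trace: "?R \<inter> trace f = {}"
    using on_trace by (auto simp: half_disc_def)
  have L: "?L \<subseteq> left_face f"
  proof -
    \<comment> \<open>As \<theta> tends to 0 from above, the sector point at radius \<open>r\<close>
      and angle \<theta> tends to \<open>m\<close> from the left, so one such point lies in the left
      half disc.\<close>
    have "((\<lambda>\<theta>. cmod (of_real r * (cis \<theta> - 1))) \<longlongrightarrow> cmod (of_real r * (cis 0 - 1))) (at_right 0)"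
      by (intro tendsto_intros)
    then have "\<forall>\<^sub>F \<theta> in at_right 0. cmod (of_real r * (cis \<theta> - 1)) < \<rho>"
      using \<rho> by (intro order_tendstoD(2)) auto
    moreover have "\<forall>\<^sub>F \<theta> in at_right (0::real). 0 < \<theta> \<and> \<theta> < min \<epsilon> pi"
      using \<epsilon>(1) by (intro eventually_at_right_real[of 0 "min \<epsilon> pi", THEN eventually_mono]) auto
    ultimately have "\<forall>\<^sub>F \<theta> in at_right 0. cmod (of_real r * (cis \<theta> - 1)) < \<rho> \<and> 0 < \<theta> \<and> \<theta> < min \<epsilon> pi"
      by (rule eventually_conj)
    then obtain \<theta> where \<theta>: "cmod (of_real r * (cis \<theta> - 1)) < \<rho>" "0 < \<theta>" "\<theta> < \<epsilon>" "\<theta> < pi"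
      using eventually_happens[of _ "at_right (0::real)"] by fastforce
    define z where "z = u + of_real r * cis \<theta> * w"
    have q: "(z - m) / w = of_real r * (cis \<theta> - 1)" using w by (simp add: z_def m_def field_simps)
    have "z \<in> ?L" unfolding half_disc_def mem_Collect_eq q using \<theta> r by (auto simp: sin_gt_zero)
    moreover have "z \<in> left_face f" using \<epsilon>(2) r \<theta> by (simp add: z_def)
    ultimately show ?thesis using left_face_absorbs[OF connected_half_disc[OF w] L_trace] by blast
  qed
  have "?R \<inter> left_face f = {}"
  proof (rule ccontr)
    assume "?R \<inter> left_face f \<noteq> {}"
    then have R: "?R \<subseteq> left_face f"
      using left_face_absorbs[OF connected_half_disc[OF w] R_trace] by blast
    obtain c where c: "simple_path c" "pathfinish c = pathstart c" "path_image c = trace f"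
      using simple_polygon_curve[OF f] .
    have fr: "frontier (inside (trace f)) = trace f" "frontier (outside (trace f)) = trace f"
      using Jordan_inside_outside[OF c(1,2)] c(3) by auto
    \<comment> \<open>A set whose frontier is the trace has points arbitrarily near
      \<open>m\<close>. Those off the trace lie in one of the half discs, both of which are now
      assumed to be in the left face.\<close>
    have near: "\<exists>z\<in>S. z \<in> left_face f" if S: "frontier S = trace f" "S \<inter> trace f = {}" for S
    proof -
      have "m \<in> trace f" using on_trace[of m] \<rho> by simp
      then have "m \<in> closure S" using S by (auto simp: frontier_def)
      then obtain z where z: "z \<in> S" "dist z m < \<rho> * cmod w"
        using \<rho> w unfolding closure_approachable by (meson mult_pos_pos zero_less_norm_iff)
      then have n: "cmod ((z - m) / w) < \<rho>" using w by (simp add: dist_norm norm_divide field_simps)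
      then have "Im ((z - m) / w) \<noteq> 0" using on_trace[OF n] z(1) S(2) by blast
      then have "z \<in> ?L \<union> ?R" using n by (auto simp: half_disc_def)
      then show ?thesis using z L R by blast
    qed
    obtain x where x: "x \<in> inside (trace f)" "x \<in> left_face f"
      using near[OF fr(1)] by auto
    obtain y where y: "y \<in> outside (trace f)" "y \<in> left_face f"
      using near[OF fr(2)] by auto
    have "y \<in> inside (trace f)"
      using inside_same_component[OF left_face_connected[OF x(2) y(2)] x(1)] .
    then show False using y(1) inside_Int_outside by blast
  qed
  \<comment> \<open>An open set disjoint from a set is disjoint from its closure.\<close>
  then have "?R \<inter> region f = {}"
    unfolding region_def using open_half_disc[OF w] by (simp add: open_Int_closure_eq_empty)
  then show ?thesis using that[of r \<rho>] r \<rho> L by (simp add: m_def u_def w_def)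
qed

section \<open>Incidences in a complex with holes and outside\<close>

locale euler_complex =
  fixes V :: "complex set" and E :: "complex set set" and F CH CO :: "plgn set"
    and d :: "plgn \<Rightarrow> real"
  assumes complex: "polygonal_complex V E F"
    and finite_V: "finite V" and finite_E: "finite E" and finite_F: "finite F"
    and pure: "pure_complex V E F"
    and holes: "holes_and_outside V E F CH CO"
    and cover: "underlying_space V E F \<union> (\<Union>h\<in>CH. region h) \<union> (\<Union>q\<in>CO. region q) = UNIV"
    and disjoint_holes: "\<forall>h\<in>CH. \<forall>c\<in>CH \<union> CO. h \<noteq> c \<longrightarrow> region h \<inter> region c = {}"
    and one_edge: "\<forall>f\<in>F. \<forall>h\<in>CH. card (sides f \<inter> sides h) \<le> 1"
    and not_adjacent: "\<forall>f\<in>F. \<forall>q\<in>CO. \<forall>i<length f.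
          \<not> (side f i \<in> sides q \<and> side f (nxt f i) \<in> sides q)"
    and offsets: "\<forall>f\<in>F. small_offset (d f) f"
begin

definition polygons :: "plgn set" where
  "polygons = F \<union> CH \<union> CO"

lemma F_polygon: "f \<in> F \<Longrightarrow> polygon f \<and> distinct f"
  using complex by (auto simp: polygonal_complex_def simple_polygon_def bounded_polygon_def)

lemma polygons_polygon: "f \<in> polygons \<Longrightarrow> polygon f"
  using holes F_polygon
  by (auto simp: polygons_def holes_and_outside_def bounded_polygon_def unbounded_polygon_def)

lemma polygons_cells:
  assumes "f \<in> polygons"
  shows "set f \<subseteq> V" "sides f \<subseteq> E"
proof -
  have "set f \<subseteq> V \<and> sides f \<subseteq> E" if "f \<in> F"
    using that complex by (auto simp: polygonal_complex_def)
  moreover have "set f \<subseteq> V \<and> sides f \<subseteq> E" if f: "f \<in> CH \<union> CO"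
  proof -
    have "(\<Union>c\<in>CH \<union> CO. set c) \<subseteq> V" "(\<Union>c\<in>CH \<union> CO. sides c) \<subseteq> E"
      using holes unfolding holes_and_outside_def by auto
    then show ?thesis using f by blast
  qed
  ultimately show "set f \<subseteq> V" "sides f \<subseteq> E" using assms by (auto simp: polygons_def)
qed

section \<open>Intersections of regions\<close>

lemma region_F_Int:
  assumes "f \<in> F" "g \<in> F" "f \<noteq> g"
  shows "region f \<inter> region g = {} \<or> (\<exists>x\<in>set f \<inter> set g. region f \<inter> region g = {x}) \<or>
        (\<exists>e\<in>sides f \<inter> sides g. region f \<inter> region g = convex hull e)"
proof -
  have "\<forall>f\<in>F. \<forall>g\<in>F. f \<noteq> g \<longrightarrow> region f \<inter> region g = {} \<or>
        (\<exists>x\<in>set f \<inter> set g. region f \<inter> region g = {x}) \<or>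
        (\<exists>e\<in>sides f \<inter> sides g. region f \<inter> region g = convex hull e)"
    using complex unfolding polygonal_complex_def by (elim conjE)
  from this[rule_format, OF assms] show ?thesis .
qed

lemma region_hole_Int:
  assumes "f \<in> F" "c \<in> CH \<union> CO"
  shows "region f \<inter> region c = (set f \<inter> set c) \<union> (\<Union>e\<in>sides f \<inter> sides c. convex hull e)"
proof -
  have "\<forall>f\<in>F. \<forall>c\<in>CH \<union> CO. region f \<inter> region c =
        (set f \<inter> set c) \<union> (\<Union>e\<in>sides f \<inter> sides c. convex hull e)"
    using holes unfolding holes_and_outside_def by (elim conjE)
  from this[rule_format, OF assms] show ?thesis .
qed

lemma region_holes_Int:
  assumes "f \<in> CH \<union> CO" "g \<in> CH \<union> CO" "f \<noteq> g"
  shows "region f \<inter> region g = {}"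
proof -
  \<comment> \<open>\<open>CO\<close> is a singleton, so one of two distinct members of
    \<open>CH \<union> CO\<close> is a hole and condition (2) applies.\<close>
  have "f \<in> CH \<or> g \<in> CH"
    using holes assms by (auto simp: holes_and_outside_def is_singleton_def)
  then show ?thesis using disjoint_holes assms by (metis Int_commute)
qed

text \<open>This treats the two intersection axioms alike: the one for two polygons of the complex
  and the one for such a polygon with a hole or the outside.\<close>

lemma region_F_Int_common_cell:
  assumes "f \<in> F" "g \<in> polygons" "f \<noteq> g" "x \<in> region f" "x \<in> region g"
  shows "x \<in> set f \<or> (\<exists>e\<in>sides f \<inter> sides g. x \<in> convex hull e)"
proof (cases "g \<in> F")
  case True
  have x: "x \<in> region f \<inter> region g" using assms by blast
  consider (vertex) y where "y \<in> set f" "region f \<inter> region g = {y}"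
    | (edge) e where "e \<in> sides f \<inter> sides g" "region f \<inter> region g = convex hull e"
    using region_F_Int[OF assms(1) True assms(3)] x by blast
  then show ?thesis
  proof cases
    case vertex then show ?thesis using x by simp
  next
    case edge then show ?thesis using x by auto
  qed
next
  case False
  then show ?thesis using region_hole_Int[of f g] assms unfolding polygons_def by blast
qed

lemma region_F_Int_trace:
  assumes "f \<in> F" "g \<in> polygons" "f \<noteq> g"
  shows "region f \<inter> region g \<subseteq> trace f"
  using region_F_Int_common_cell[OF assms] set_subset_trace[of f] unfolding trace_def by blast

text \<open>The intersection of the regions lies on the boundary of \<open>f\<close>, which the left
  face avoids. The whole region of \<open>g\<close> is taken because corners of holes and of the
  outside stay on the boundary under the transformation.\<close>

lemma left_face_Int_region:
  assumes "f \<in> F" "g \<in> polygons" "f \<noteq> g"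
  shows "left_face f \<inter> region g = {}"
  using region_F_Int_trace[OF assms] left_face_trace[of f] left_face_subset_region[of f] by blast

lemma left_face_Int:
  assumes "f \<in> polygons" "g \<in> polygons" "f \<noteq> g"
  shows "left_face f \<inter> left_face g = {}"
proof -
  have sub: "left_face f \<subseteq> region f" "left_face g \<subseteq> region g"
    by (rule left_face_subset_region)+
  consider "f \<in> F" | "g \<in> F" | "f \<in> CH \<union> CO" "g \<in> CH \<union> CO"
    using assms unfolding polygons_def by blast
  then show ?thesis
  proof cases
    case 1 then show ?thesis using left_face_Int_region[of f g] assms sub by blast
  next
    case 2 then show ?thesis using left_face_Int_region[of g f] assms sub by blast
  next
    case 3 then show ?thesis using region_holes_Int[of f g] assms sub by blast
  qed
qed

text \<open>All polygons have their face on the left; equal directions would make two disjoint left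
  faces overlap.\<close>

lemma common_side_opposite:
  assumes "f \<in> polygons" "g \<in> polygons" "f \<noteq> g" "i < length f" "j < length g"
    and "side f i = side g j"
  shows "f ! i = g ! nxt g j" "f ! nxt f i = g ! j"
proof -
  have "\<not> (f ! i = g ! j \<and> f ! nxt f i = g ! nxt g j)"
    using common_directed_side[of f i g j] left_face_Int[of f g] polygons_polygon assms by blast
  then show "f ! i = g ! nxt g j" "f ! nxt f i = g ! j"
    using assms(6) by (auto simp: side_def doubleton_eq_iff)
qed

text \<open>Finiteness of \<open>CH\<close> is derived: a polygon is a list over \<open>V\<close>
  whose sides are distinct members of \<open>E\<close>, so its length is at most
  \<open>card E\<close>.\<close>

lemma finite_polygons: "finite polygons"
proof -
  have "length f \<le> card E" if "f \<in> polygons" for f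
  proof -
    have "card (sides f) = length f"
      using card_image[OF polygon_side_inj[OF polygons_polygon[OF that]]] by (simp add: sides_def)
    then show ?thesis using card_mono[OF finite_E polygons_cells(2)[OF that]] by simp
  qed
  then have "polygons \<subseteq> {f. set f \<subseteq> V \<and> length f \<le> card E}"
    using polygons_cells(1) by blast
  then show ?thesis using finite_lists_length_le[OF finite_V] finite_subset by blast
qed

text \<open>By condition (1) only points of vertices and edges can be missed, a negligible set. The
  missed set is also open, since finitely many closed regions are removed, and hence it is
  empty.\<close>

lemma regions_cover: "(\<Union>f\<in>polygons. region f) = UNIV"
proof -
  let ?U = "\<Union>f\<in>polygons. region f"
  have "negligible (convex hull e)" if e: "e \<in> E" for e
  proof -
    have "\<forall>e\<in>E. \<exists>u\<in>V. \<exists>v\<in>V. u \<noteq> v \<and> e = {u, v}"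
      using complex unfolding polygonal_complex_def by (elim conjE)
    then obtain u v where "e = {u, v}" using e by blast
    \<comment> \<open>Two points do not suffice to span the plane, so their hull has empty
      interior.\<close>
    moreover have "card {u, v} \<le> DIM(complex)" by (simp add: card_insert_if)
    ultimately have "interior (convex hull e) = {}"
      by (intro empty_interior_convex_hull) auto
    then show ?thesis by (simp add: negligible_convex_interior convex_convex_hull)
  qed
  then have "negligible (\<Union>((hull) convex ` E))"
    using finite_E by (intro negligible_Union) auto
  then have "negligible (V \<union> (\<Union>e\<in>E. convex hull e))"
    by (rule negligible_Un[OF negligible_finite[OF finite_V]])
  moreover have "- ?U \<subseteq> V \<union> (\<Union>e\<in>E. convex hull e)"
  proof
    fix x assume "x \<in> - ?U"
    moreover have "x \<in> underlying_space V E F \<union> (\<Union>h\<in>CH. region h) \<union> (\<Union>q\<in>CO. region q)"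
      using cover by simp
    ultimately show "x \<in> V \<union> (\<Union>e\<in>E. convex hull e)"
      by (auto simp: underlying_space_def polygons_def)
  qed
  ultimately have "negligible (- ?U)" by (rule negligible_subset)
  moreover have "open (- ?U)"
    using finite_polygons by (intro open_Compl closed_UN) (auto simp: region_def)
  ultimately show ?thesis using open_not_negligible by blast
qed

text \<open>By the Jordan curve theorem \<open>f\<close> lies on one side of each of its sides only; by condition (1)
  another polygon covers the other side.\<close>

lemma second_polygon_at_side:
  assumes f: "f \<in> F" and i: "i < length f"
  shows "\<exists>g\<in>polygons. g \<noteq> f \<and> side f i \<in> sides g"
proof -
  have pf: "polygon f" "distinct f" using F_polygon[OF f] by auto
  let ?w = "f ! nxt f i - f ! i"
  obtain r \<rho> where r: "0 < r" "r < 1" "0 < \<rho>"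
    and L: "half_disc True (f ! i + of_real r * ?w) ?w \<rho> \<subseteq> left_face f"
    and R: "half_disc False (f ! i + of_real r * ?w) ?w \<rho> \<inter> region f = {}"
    using simple_polygon_side[OF pf i] .
  define m where "m = f ! i + of_real r * ?w"
  let ?R = "half_disc False m ?w \<rho>"
  have w: "?w \<noteq> 0" using polygon_side_neq[OF pf(1) i] by simp
  \<comment> \<open>Finitely many regions cover the right half disc, so one of them has points in it
    accumulating at \<open>m\<close>. It is not that of \<open>f\<close>, whose region misses this
    half disc.\<close>
  have "m \<in> closure (\<Union>g\<in>polygons. ?R \<inter> region g)"
    using centre_in_closure_half_disc[OF w r(3), of m False] regions_cover
    by (simp flip: Int_UN_distrib)
  also have "\<dots> = (\<Union>g\<in>polygons. closure (?R \<inter> region g))"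
    by (rule closure_finite_UN[OF finite_polygons])
  finally obtain g where g: "g \<in> polygons" "m \<in> closure (?R \<inter> region g)" by blast
  have "g \<noteq> f" using g(2) R by (auto simp: m_def)
  have "m \<in> region g"
    using g(2) closure_mono[of "?R \<inter> region g" "region g"] by (auto simp: region_def)
  have "m \<in> region f"
    using centre_in_closure_half_disc[OF w r(3), of m True] closure_mono[OF L]
    by (auto simp: region_def m_def)
  have on_side: "k = i" if "k < length f" "m \<in> convex hull (side f k)" for k
    using polygon_point_on_side[OF pf(1) i that(1) r(1,2)] that(2) by (simp add: m_def)
  \<comment> \<open>As \<open>m\<close> is no vertex, the common cell containing it must be an edge,
    and the only side of \<open>f\<close> through \<open>m\<close> is the
    \<open>i\<close>-th.\<close>
  have "m \<notin> set f"
  proof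
    assume m: "m \<in> set f"
    then obtain k where k: "k < length f" "m = f ! k" by (auto simp: in_set_conv_nth)
    then have "k = i" using on_side nth_in_side(1) by (metis hull_inc)
    then show False
      using k interior_point_of_segment(2)[OF polygon_side_neq[OF pf(1) i] r(1,2)]
      by (simp add: m_def)
  qed
  then obtain e where e: "e \<in> sides f" "e \<in> sides g" "m \<in> convex hull e"
    using region_F_Int_common_cell[OF f g(1) \<open>g \<noteq> f\<close>[symmetric] \<open>m \<in> region f\<close> \<open>m \<in> region g\<close>]
    by blast
  then have "e = side f i" using on_side by (auto simp: sides_def)
  then show ?thesis using e g(1) \<open>g \<noteq> f\<close> by blast
qed

text \<open>For \<open>g\<close> in the complex, the regions would share three distinct vertices of
  \<open>f\<close>, whereas their intersection is at most one edge and contains only two. For a hole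
  this contradicts condition (3), for the outside condition (4).\<close>

lemma not_both_adjacent_sides:
  assumes f: "f \<in> F" and g: "g \<in> polygons" "f \<noteq> g" and i: "i < length f"
    and s: "side f i \<in> sides g" "side f (nxt f i) \<in> sides g"
  shows False
proof -
  have pf: "polygon f" "distinct f" using F_polygon[OF f] by auto
  have len: "3 \<le> length f" using polygon_length[OF pf(1)] .
  have ni: "nxt f i < length f" using nxt_less[OF i] .
  have nni: "nxt f (nxt f i) < length f" using nxt_less[OF ni] .
  consider "g \<in> F" | "g \<in> CH" | "g \<in> CO" using g(1) by (auto simp: polygons_def)
  then show False
  proof cases
    case 1
    let ?X = "{f ! i, f ! nxt f i, f ! nxt f (nxt f i)}"
    have "nxt f i \<noteq> i" "nxt f (nxt f i) \<noteq> nxt f i" "nxt f (nxt f i) \<noteq> i"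
      using nxt_neq[OF i] nxt_neq[OF ni] nxt_nxt_neq[OF i] len by auto
    then have card: "card ?X = 3"
      using pf(2) i ni nni by (simp add: nth_eq_iff_index_eq)
    have "?X \<subseteq> set f" using i ni nni by auto
    have "?X \<subseteq> set g" using s[THEN sides_subset_set] by (auto simp: side_def)
    have "?X \<subseteq> region f"
      using \<open>?X \<subseteq> set f\<close> set_subset_region[OF pf(1)] by (rule order_trans)
    moreover have "?X \<subseteq> region g"
      using \<open>?X \<subseteq> set g\<close> set_subset_region[OF polygons_polygon[OF g(1)]] by (rule order_trans)
    ultimately have X: "?X \<subseteq> region f \<inter> region g" by (rule Int_greatest)
    have "region f \<inter> region g \<noteq> {x}" for x
    proof
      assume "region f \<inter> region g = {x}"
      then have "card ?X \<le> card {x}" using X by (intro card_mono) simp_all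
      then show False using card by simp
    qed
    moreover have "region f \<inter> region g \<noteq> {}" using X by (metis insert_not_empty subset_empty)
    ultimately obtain e where e: "e \<in> sides f" "region f \<inter> region g = convex hull e"
      using region_F_Int[OF f 1 g(2)] by (metis Int_iff)
    then obtain k where k: "k < length f" "e = side f k" by (auto simp: sides_def)
    then have "?X \<subseteq> side f k"
      using X \<open>?X \<subseteq> set f\<close> polygon_vertex_on_side[OF pf(1) _ k(1)]
      unfolding e(2) k(2) by (meson subset_iff)
    then have "card ?X \<le> card (side f k)" by (intro card_mono) (simp_all add: side_def)
    also have "\<dots> \<le> 2" by (simp add: side_def card_insert_if)
    finally show False using card by simp
  next
    case 2
    have "side f i \<noteq> side f (nxt f i)"
      using polygon_side_inj[OF pf(1)] i ni nxt_neq[OF i] len by (auto dest: inj_onD)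
    then have "card {side f i, side f (nxt f i)} = 2" by simp
    moreover have "card {side f i, side f (nxt f i)} \<le> card (sides f \<inter> sides g)"
      using s i ni by (intro card_mono) (auto simp: sides_def)
    ultimately show False using one_edge f 2 by force
  next
    case 3
    then show False using not_adjacent f i s by blast
  qed
qed

section \<open>Corners and their images\<close>

text \<open>A pair \<open>(f, i)\<close> stands both for the \<open>i\<close>-th corner of \<open>f\<close> and for its \<open>i\<close>-th side, traversed
  from the corner \<open>(f, i)\<close> to the corner \<open>succ (f, i)\<close>.\<close>

definition corners :: "(plgn \<times> nat) set" where
  "corners = (SIGMA f:polygons. {..<length f})"

definition pt :: "plgn \<times> nat \<Rightarrow> complex" where
  "pt c = fst c ! snd c"

definition succ :: "plgn \<times> nat \<Rightarrow> plgn \<times> nat" where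
  "succ c = (fst c, nxt (fst c) (snd c))"

definition edge :: "plgn \<times> nat \<Rightarrow> complex set" where
  "edge c = side (fst c) (snd c)"

definition hcorner :: "plgn \<times> nat \<Rightarrow> hvert" where
  "hcorner c = corner (hat F d (fst c)) (snd c)"

text \<open>The description is meaningful on \<open>corners\<close>: existence and uniqueness are
  proved in lemma \<open>mate\<close>.\<close>

definition mate :: "plgn \<times> nat \<Rightarrow> plgn \<times> nat" where
  "mate c = (THE c'. c' \<in> corners \<and> c' \<noteq> c \<and> edge c' = edge c)"

lemma fst_succ [simp]: "fst (succ c) = fst c"
  by (simp add: succ_def)

lemma succ_corners: "c \<in> corners \<Longrightarrow> succ c \<in> corners"
  by (auto simp: corners_def succ_def nxt_less)

lemma succ_succ_neq: "c \<in> corners \<Longrightarrow> succ (succ c) \<noteq> c"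
  using nxt_nxt_neq polygon_length[OF polygons_polygon]
  by (fastforce simp: corners_def succ_def)

lemma edge_eq: "edge c = {pt c, pt (succ c)}"
  by (simp add: edge_def side_def pt_def succ_def)

lemma pt_succ_neq: "c \<in> corners \<Longrightarrow> pt (succ c) \<noteq> pt c"
  using polygon_side_neq[OF polygons_polygon] by (force simp: corners_def pt_def succ_def)

lemma edge_in_E: "c \<in> corners \<Longrightarrow> edge c \<in> E"
  by (auto simp: corners_def edge_def intro!: subsetD[OF polygons_cells(2)] side_in_sides)

lemma pt_in_V: "c \<in> corners \<Longrightarrow> pt c \<in> V"
  using polygons_cells(1) by (force simp: corners_def pt_def)

lemma finite_corners: "finite corners"
  using finite_polygons by (simp add: corners_def)

section \<open>The two corners at an edge\<close>

lemma same_polygon_same_edge: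
  assumes "c \<in> corners" "c' \<in> corners" "fst c = fst c'" "edge c = edge c'"
  shows "c = c'"
  using assms polygon_side_inj[OF polygons_polygon, of "fst c"]
  by (auto simp: corners_def edge_def inj_on_eq_iff)

lemma opposite_corners:
  assumes "c \<in> corners" "c' \<in> corners" "c \<noteq> c'" "edge c = edge c'"
  shows "pt c' = pt (succ c)" "pt (succ c') = pt c"
proof -
  have "fst c \<noteq> fst c'" using same_polygon_same_edge assms by blast
  then show "pt c' = pt (succ c)" "pt (succ c') = pt c"
    using common_side_opposite[of "fst c" "fst c'" "snd c" "snd c'"] assms
    by (auto simp: corners_def edge_def pt_def succ_def)
qed

text \<open>Both \<open>b\<close> and \<open>c\<close> would run opposite to \<open>a\<close>, hence
  in the same direction, but they would also run opposite to each other.\<close>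

lemma at_most_two_corners:
  assumes "a \<in> corners" "b \<in> corners" "c \<in> corners" "edge a = edge b" "edge a = edge c" "a \<noteq> b" "a \<noteq> c"
  shows "b = c"
proof (rule ccontr)
  assume "b \<noteq> c"
  then have "pt c = pt (succ b)" using opposite_corners(1)[of b c] assms by simp
  moreover have "pt b = pt c"
    using opposite_corners(1)[of a b] opposite_corners(1)[of a c] assms by simp
  ultimately show False using pt_succ_neq[of b] assms by simp
qed

text \<open>Purity supplies the polygon in \<open>F\<close>, and
  \<open>second_polygon_at_side\<close> the one across the edge.\<close>

lemma edge_corners:
  assumes "e \<in> E"
  obtains a b where "a \<in> corners" "b \<in> corners" "a \<noteq> b" "edge a = e" "edge b = e" "fst a \<in> F"
proof -
  obtain f where f: "f \<in> F" "e \<in> sides f" using pure assms unfolding pure_complex_def by blast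
  then obtain i where i: "i < length f" "e = side f i" by (auto simp: sides_def)
  obtain g where g: "g \<in> polygons" "g \<noteq> f" "e \<in> sides g"
    using second_polygon_at_side[OF f(1) i(1)] i by blast
  then obtain j where j: "j < length g" "e = side g j" by (auto simp: sides_def)
  show ?thesis
    using that[of "(f, i)" "(g, j)"] f g i j by (auto simp: corners_def edge_def polygons_def)
qed

lemma mate:
  assumes c: "c \<in> corners"
  shows "mate c \<in> corners" "mate c \<noteq> c" "edge (mate c) = edge c"
    and mate_unique: "\<And>a. a \<in> corners \<Longrightarrow> edge a = edge c \<Longrightarrow> a \<noteq> c \<Longrightarrow> a = mate c"
    and mate_F: "fst c \<in> F \<or> fst (mate c) \<in> F"
proof -
  obtain a b where ab: "a \<in> corners" "b \<in> corners" "a \<noteq> b" "edge a = edge c" "edge b = edge c" "fst a \<in> F"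
    using edge_corners[OF edge_in_E[OF c]] .
  then have "\<exists>c'. c' \<in> corners \<and> c' \<noteq> c \<and> edge c' = edge c" by metis
  then have "\<exists>!c'. c' \<in> corners \<and> c' \<noteq> c \<and> edge c' = edge c"
    using at_most_two_corners[OF c] by metis
  then have m: "mate c \<in> corners \<and> mate c \<noteq> c \<and> edge (mate c) = edge c"
    unfolding mate_def by (rule theI')
  then show "mate c \<in> corners" "mate c \<noteq> c" "edge (mate c) = edge c" by auto
  show u: "a = mate c" if "a \<in> corners" "edge a = edge c" "a \<noteq> c" for a
    using at_most_two_corners[OF c that(1), of "mate c"] m that by metis
  \<comment> \<open>The corner \<open>a\<close> at this edge belongs to a polygon of
    \<open>F\<close>, and it is either \<open>c\<close> or its mate.\<close>
  show "fst c \<in> F \<or> fst (mate c) \<in> F" using u[of a] ab by blast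
qed

lemma mate_mate: "c \<in> corners \<Longrightarrow> mate (mate c) = c"
  using mate_unique[OF mate(1), of c c] mate[of c] by metis

lemma pt_mate:
  assumes "c \<in> corners"
  shows "pt (mate c) = pt (succ c)" "pt (succ (mate c)) = pt c"
  using opposite_corners[OF assms mate(1)[OF assms] mate(2)[OF assms, symmetric]
      mate(3)[OF assms, symmetric]] by simp_all

lemma fst_mate_neq: "c \<in> corners \<Longrightarrow> fst (mate c) \<noteq> fst c"
  using same_polygon_same_edge[of "mate c" c] mate(1-3)[of c] by blast

lemma corners_of_edge:
  assumes c: "c \<in> corners"
  shows "{a \<in> corners. edge a = edge c} = {c, mate c}"
proof
  show "{a \<in> corners. edge a = edge c} \<subseteq> {c, mate c}" using mate_unique[OF c] by blast
  show "{c, mate c} \<subseteq> {a \<in> corners. edge a = edge c}" using mate(1,3)[OF c] c by simp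
qed

section \<open>Counting the corners\<close>

lemma edge_image: "edge ` corners = E"
proof
  show "edge ` corners \<subseteq> E" using edge_in_E by blast
  show "E \<subseteq> edge ` corners" using edge_corners by blast
qed

lemma pt_image: "pt ` corners = V"
proof
  show "pt ` corners \<subseteq> V" using pt_in_V by blast
  show "V \<subseteq> pt ` corners"
  proof
    fix v assume "v \<in> V"
    then obtain f where f: "f \<in> F" "v \<in> set f" using pure unfolding pure_complex_def by blast
    then obtain i where "i < length f" "f ! i = v" by (auto simp: in_set_conv_nth)
    then have "(f, i) \<in> corners" "pt (f, i) = v"
      using f by (auto simp: corners_def polygons_def pt_def)
    then show "v \<in> pt ` corners" by blast
  qed
qed

text \<open>The fibres of \<open>edge\<close> over \<open>E\<close> are the pairs
  \<open>{c, mate c}\<close>.\<close>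

lemma card_corners: "card corners = 2 * card E"
proof -
  have "corners = (\<Union>e\<in>E. {c \<in> corners. edge c = e})" using edge_in_E by blast
  also have "card \<dots> = (\<Sum>e\<in>E. card {c \<in> corners. edge c = e})"
    using finite_E finite_corners by (intro card_UN_disjoint) auto
  also have "\<dots> = (\<Sum>e\<in>E. 2)"
  proof (rule sum.cong)
    fix e assume "e \<in> E"
    then obtain c where c: "c \<in> corners" "edge c = e" using edge_image by blast
    then show "card {c \<in> corners. edge c = e} = 2"
      using corners_of_edge[OF c(1)] mate(2)[OF c(1), symmetric] by simp
  qed simp
  finally show ?thesis by simp
qed

section \<open>Copies of corners\<close>

lemma hcorner_point:
  assumes f: "f \<in> F" and i: "i < length f"
  shows "fst (hcorner (f, i)) \<in> left_face f"
proof -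
  let ?g = "offset (d f) f"
  have "simple_polygon ?g" "region ?g \<subseteq> left_face f"
    using offsets f by (auto simp: small_offset_def)
  \<comment> \<open>A vertex of the offset polygon lies in its region, which is contained in the
    left face of \<open>f\<close>.\<close>
  moreover have "?g ! i \<in> set ?g" using i by (intro nth_mem) (simp add: offset_def)
  ultimately have "?g ! i \<in> left_face f"
    using vertex_in_region[of ?g] by (auto simp: simple_polygon_def bounded_polygon_def)
  then show ?thesis using f by (simp add: hcorner_def corner_def hat_def)
qed

lemma hcorner_in_region:
  assumes "c \<in> corners"
  shows "fst (hcorner c) \<in> region (fst c)"
proof (cases "fst c \<in> F")
  case True
  then show ?thesis
    using hcorner_point[of "fst c" "snd c"] left_face_subset_region[of "fst c"] assms
    by (auto simp: corners_def)
next
  case False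
  then have "fst (hcorner c) = fst c ! snd c" by (simp add: hcorner_def corner_def hat_def)
  then show ?thesis using assms vertex_in_region[OF polygons_polygon] by (auto simp: corners_def)
qed

text \<open>Copies in different polygons differ as points: either one lies in a left face that
  misses the other region, or both regions are disjoint. Within one polygon the multiplicity index
  settles the matter.\<close>

lemma inj_hcorner: "inj_on hcorner corners"
proof (rule inj_onI)
  fix a b assume a: "a \<in> corners" and b: "b \<in> corners" and eq: "hcorner a = hcorner b"
  have no: False if "fst a \<noteq> fst b" "fst a \<in> F" "a \<in> corners" "b \<in> corners" "hcorner a = hcorner b" for a b
    using hcorner_point[of "fst a" "snd a"] hcorner_in_region[of b]
      left_face_Int_region[of "fst a" "fst b"] that
    by (auto simp: corners_def)
  have "fst a = fst b"
  proof (rule ccontr)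
    assume neq: "fst a \<noteq> fst b"
    then have "fst a \<notin> F" "fst b \<notin> F" using no[of a b] no[of b a] a b eq by auto
    then have "region (fst a) \<inter> region (fst b) = {}"
      using a b neq by (intro region_holes_Int) (auto simp: corners_def polygons_def)
    then show False using hcorner_in_region[OF a] hcorner_in_region[OF b] eq by auto
  qed
  then show "a = b" using eq corner_inj by (auto simp: hcorner_def prod_eq_iff)
qed

lemma hcorner_eq_iff: "a \<in> corners \<Longrightarrow> b \<in> corners \<Longrightarrow> hcorner a = hcorner b \<longleftrightarrow> a = b"
  using inj_hcorner by (auto dest: inj_onD)

section \<open>Cells of the transformed complex\<close>

text \<open>The edges of the transformed complex: \<open>hside c\<close> is parallel to the side \<open>c\<close>, and \<open>hlink c\<close> joins the
  two copies of the starting point of \<open>c\<close> in the polygons sharing that side (which traverse it in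
  opposite directions).\<close>

definition hside :: "plgn \<times> nat \<Rightarrow> hvert set" where
  "hside c = {hcorner c, hcorner (succ c)}"

definition hlink :: "plgn \<times> nat \<Rightarrow> hvert set" where
  "hlink c = {hcorner c, hcorner (succ (mate c))}"

text \<open>Equality with exchanged end points would give a polygon with two corners only.\<close>

lemma inj_hside: "inj_on hside corners"
proof (rule inj_onI)
  fix a b assume a: "a \<in> corners" and b: "b \<in> corners" and "hside a = hside b"
  then have "a = b \<or> (a = succ b \<and> succ a = b)"
    using succ_corners hcorner_eq_iff by (auto simp: hside_def doubleton_eq_iff)
  then show "a = b" using succ_succ_neq[OF b] by auto
qed

text \<open>A copied side joins corners of one polygon, a link joins corners of two different
  polygons.\<close>

lemma hside_neq_hlink:
  assumes "a \<in> corners" "b \<in> corners"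
  shows "hside a \<noteq> hlink b"
proof
  assume "hside a = hlink b"
  then have "(a = b \<and> succ a = succ (mate b)) \<or> (a = succ (mate b) \<and> succ a = b)"
    using assms succ_corners mate(1) hcorner_eq_iff
    by (auto simp: hside_def hlink_def doubleton_eq_iff)
  then show False using fst_mate_neq[OF assms(2)] fst_succ by metis
qed

text \<open>Two links can only coincide if two polygons share two adjacent sides, which conditions (3)
  and (4) exclude.\<close>

lemma inj_hlink: "inj_on hlink corners"
proof (rule inj_onI)
  fix a b assume a: "a \<in> corners" and b: "b \<in> corners" and "hlink a = hlink b"
  then have "a = b \<or> (a = succ (mate b) \<and> b = succ (mate a))"
    using succ_corners mate(1) hcorner_eq_iff by (auto simp: hlink_def doubleton_eq_iff)
  \<comment> \<open>The polygon of \<open>a\<close> runs through \<open>mate b\<close> and then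
    \<open>a\<close>, that of \<open>b\<close> through \<open>mate a\<close> and then
    \<open>b\<close>; so both contain the adjacent edges \<open>edge a\<close> and
    \<open>edge b\<close>.\<close>
  moreover have False if ab: "a = succ (mate b)" "b = succ (mate a)"
  proof -
    have two: False
      if a: "a \<in> corners" and b: "b \<in> corners" and "a = succ (mate b)" "b = succ (mate a)" "fst a \<in> F"
      for a b
    proof -
      have fst: "fst (mate b) = fst a" "fst (mate a) = fst b" using that fst_succ by metis+
      have mb: "mate b \<in> corners" "mate a \<in> corners" using mate(1) a b by auto
      have "side (fst a) (snd (mate b)) = edge b"
        using mate(3)[OF b] fst by (simp add: edge_def)
      moreover have "side (fst a) (nxt (fst a) (snd (mate b))) = edge (mate a)"
        using mate(3)[OF a] \<open>a = succ (mate b)\<close> fst by (metis edge_def succ_def snd_conv)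
      moreover have "edge b \<in> sides (fst b)" "edge (mate a) \<in> sides (fst b)"
        using b mb fst by (auto simp: edge_def corners_def intro!: side_in_sides)
      ultimately show False
        using not_both_adjacent_sides[of "fst a" "fst b" "snd (mate b)"] \<open>fst a \<in> F\<close>
          fst_mate_neq[OF a] fst mb(1) b by (auto simp: corners_def)
    qed
    \<comment> \<open>The situation is symmetric in \<open>a\<close> and \<open>b\<close>. As
      \<open>mate a\<close> lies in the polygon of \<open>b\<close>, \<open>mate_F\<close> puts one
      of the two polygons in \<open>F\<close>.\<close>
    show False using two[OF a b ab] two[OF b a ab(2,1)] mate_F[OF a] ab fst_succ by metis
  qed
  ultimately show "a = b" by blast
qed

section \<open>The three classes in terms of corners\<close>

lemma copy_eq:
  assumes "x \<in> edge c"
  shows "copy F d (fst c) (snd c) x = (if x = pt c then hcorner c else hcorner (succ c))"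
  using assms by (simp add: copy_def hcorner_def pt_def succ_def)

text \<open>Edge sets of all three classes have this form: class 1 has only sides, class 3 only
  links, class 2 both.\<close>

definition hcell :: "(plgn \<times> nat) set \<Rightarrow> (plgn \<times> nat) set \<Rightarrow> hvert set set" where
  "hcell A B = hside ` A \<union> hlink ` B"

text \<open>\<open>hside\<close> and \<open>hlink\<close> are injective with disjoint images, so an
  edge set reveals the corners that produce it. Polygons can therefore be compared through sets of
  corners.\<close>

lemma hcell_inject:
  assumes "A \<subseteq> corners" "B \<subseteq> corners" "A' \<subseteq> corners" "B' \<subseteq> corners" "hcell A B = hcell A' B'"
  shows "A = A'" "B = B'"
proof -
  have side: "hside c \<in> hcell A B \<longleftrightarrow> c \<in> A" and link: "hlink c \<in> hcell A B \<longleftrightarrow> c \<in> B"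
    if "A \<subseteq> corners" "B \<subseteq> corners" "c \<in> corners" for A B c
  proof -
    have "hside c \<notin> hlink ` B"
    proof
      assume "hside c \<in> hlink ` B"
      then obtain b where "b \<in> B" "hside c = hlink b" by (rule imageE)
      then show False using hside_neq_hlink[OF that(3)] that(2) by blast
    qed
    moreover have "hlink c \<notin> hside ` A"
    proof
      assume "hlink c \<in> hside ` A"
      then obtain a where "a \<in> A" "hlink c = hside a" by (rule imageE)
      then show False using hside_neq_hlink[of a c] that(1,3) by auto
    qed
    ultimately show "hside c \<in> hcell A B \<longleftrightarrow> c \<in> A" "hlink c \<in> hcell A B \<longleftrightarrow> c \<in> B"
      using inj_on_image_mem_iff[OF inj_hside that(3,1)]
        inj_on_image_mem_iff[OF inj_hlink that(3,2)]
      by (simp_all add: hcell_def)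
  qed
  have mem: "c \<in> A \<longleftrightarrow> c \<in> A'" "c \<in> B \<longleftrightarrow> c \<in> B'" if "c \<in> corners" for c
    using side[OF assms(1,2) that] side[OF assms(3,4) that]
      link[OF assms(1,2) that] link[OF assms(3,4) that] unfolding assms(5) by simp_all
  show "A = A'" using mem(1) assms(1,3) by blast
  show "B = B'" using mem(2) assms(2,4) by blast
qed

lemma image_corners_of: "g ` ({f} \<times> {..<n}) = {g (f, i) | i. i < n}"
  by auto

lemma class1_eq:
  "class1 F d = (\<lambda>f. (hcorner ` ({f} \<times> {..<length f}), hcell ({f} \<times> {..<length f}) {})) ` F"
  unfolding class1_def hcell_def image_corners_of hside_def hcorner_def succ_def
  by (simp add: Setcompr_eq_image)

definition at_edge :: "complex set \<Rightarrow> (plgn \<times> nat) set" where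
  "at_edge e = {c \<in> corners. edge c = e}"

definition at_vertex :: "complex \<Rightarrow> (plgn \<times> nat) set" where
  "at_vertex v = {c \<in> corners. pt c = v}"

definition quad :: "complex \<Rightarrow> complex \<Rightarrow> plgn \<times> nat \<Rightarrow> plgn \<times> nat \<Rightarrow> hplgn" where
  "quad u v c m =
    ({copy F d (fst c) (snd c) u, copy F d (fst c) (snd c) v,
      copy F d (fst m) (snd m) v, copy F d (fst m) (snd m) u},
     {{copy F d (fst c) (snd c) u, copy F d (fst c) (snd c) v},
      {copy F d (fst c) (snd c) v, copy F d (fst m) (snd m) v},
      {copy F d (fst m) (snd m) u, copy F d (fst m) (snd m) v},
      {copy F d (fst c) (snd c) u, copy F d (fst m) (snd m) u}})"

lemma class2_quads:
  "class2 E F CH CO d = {quad u v (f, i) (f', j) | u v f f' i j.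
     {u, v} \<in> E \<and> f \<in> F \<and> f' \<in> polygons \<and> f \<noteq> f' \<and>
     i < length f \<and> j < length f' \<and> side f i = {u, v} \<and> side f' j = {u, v}}"
  by (simp only: class2_def quad_def polygons_def fst_conv snd_conv)

lemma quad_eq:
  assumes c: "c \<in> corners" and uv: "edge c = {u, v}"
  defines "m \<equiv> mate c"
  shows "quad u v c m =
    (hcorner ` (at_edge {u, v} \<union> succ ` at_edge {u, v}), hcell (at_edge {u, v}) (at_edge {u, v}))"
proof -
  have at: "at_edge {u, v} = {c, m}"
    using corners_of_edge[OF c] uv by (simp add: at_edge_def m_def)
  have mm: "mate m = c" using mate_mate[OF c] by (simp add: m_def)
  have pts: "pt m = pt (succ c)" "pt (succ m) = pt c" using pt_mate[OF c] by (auto simp: m_def)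
  have neq: "pt (succ c) \<noteq> pt c" using pt_succ_neq[OF c] .
  have em: "edge m = {u, v}" using mate(3)[OF c] uv by (simp add: m_def)
  have copies: "copy F d (fst c) (snd c) x = (if x = pt c then hcorner c else hcorner (succ c))"
    "copy F d (fst m) (snd m) x = (if x = pt m then hcorner m else hcorner (succ m))"
    if "x \<in> {u, v}" for x
    using copy_eq[of x c] copy_eq[of x m] that uv em by auto
  \<comment> \<open>The edge comes unoriented, so \<open>u\<close> may be either end of
    \<open>c\<close>; the resulting cell is the same.\<close>
  consider "u = pt c" "v = pt (succ c)" | "v = pt c" "u = pt (succ c)"
    using uv by (auto simp: edge_eq doubleton_eq_iff)
  then show ?thesis
  proof cases
    case 1
    then have "copy F d (fst c) (snd c) u = hcorner c" "copy F d (fst c) (snd c) v = hcorner (succ c)"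
      "copy F d (fst m) (snd m) v = hcorner m" "copy F d (fst m) (snd m) u = hcorner (succ m)"
      using copies[of u] copies[of v] pts neq by auto
    then show ?thesis
      unfolding at quad_def hcell_def hside_def hlink_def by (simp add: mm insert_commute flip: m_def)
  next
    case 2
    then have "copy F d (fst c) (snd c) v = hcorner c" "copy F d (fst c) (snd c) u = hcorner (succ c)"
      "copy F d (fst m) (snd m) u = hcorner m" "copy F d (fst m) (snd m) v = hcorner (succ m)"
      using copies[of u] copies[of v] pts neq by auto
    then show ?thesis
      unfolding at quad_def hcell_def hside_def hlink_def by (simp add: mm insert_commute flip: m_def)
  qed
qed

lemma class2_eq:
  "class2 E F CH CO d =
    (\<lambda>e. (hcorner ` (at_edge e \<union> succ ` at_edge e), hcell (at_edge e) (at_edge e))) ` E"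
    (is "_ = ?q ` E")
proof
  show "class2 E F CH CO d \<subseteq> ?q ` E"
  proof
    fix p assume "p \<in> class2 E F CH CO d"
    then obtain u v f g i j where p: "p = quad u v (f, i) (g, j)"
      and h: "{u, v} \<in> E" "f \<in> F" "g \<in> polygons" "f \<noteq> g" "i < length f" "j < length g"
        "side f i = {u, v}" "side g j = {u, v}"
      unfolding class2_quads by (elim CollectE exE conjE) (rule that)
    have c: "(f, i) \<in> corners" "(g, j) \<in> corners" "edge (f, i) = {u, v}" "edge (g, j) = {u, v}"
      using h by (auto simp: corners_def polygons_def edge_def)
    then have "mate (f, i) = (g, j)"
      using mate_unique[OF c(1) c(2)] \<open>f \<noteq> g\<close> by simp
    then have "p = ?q {u, v}" using quad_eq[OF c(1,3)] p by simp
    then show "p \<in> ?q ` E" using h(1) by blast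
  qed
  show "?q ` E \<subseteq> class2 E F CH CO d"
  proof
    fix p assume "p \<in> ?q ` E"
    then obtain e where e: "e \<in> E" "p = ?q e" by blast
    \<comment> \<open>\<open>class2\<close> asks for the first polygon to be in \<open>F\<close>,
      which fixes the choice among the two corners at \<open>e\<close>.\<close>
    obtain c where c: "c \<in> corners" "edge c = e" "fst c \<in> F" using edge_corners[OF e(1)] by metis
    let ?m = "mate c"
    have m: "?m \<in> corners" "edge ?m = e" "fst c \<noteq> fst ?m"
      using mate(1,3)[OF c(1)] fst_mate_neq[OF c(1)] c(2) by simp_all
    have uv: "e = {pt c, pt (succ c)}" using c(2) edge_eq by simp
    then have "p = quad (pt c) (pt (succ c)) (fst c, snd c) (fst ?m, snd ?m)"
      using quad_eq[OF c(1), of "pt c" "pt (succ c)"] c(2) e(2) by simp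
    moreover have "{pt c, pt (succ c)} \<in> E" "side (fst c) (snd c) = {pt c, pt (succ c)}"
      "side (fst ?m) (snd ?m) = {pt c, pt (succ c)}"
      using e(1) uv c(2) m(2) by (simp_all add: edge_def)
    moreover have "fst ?m \<in> polygons" "snd c < length (fst c)" "snd ?m < length (fst ?m)"
      using c(1) m(1) by (auto simp: corners_def)
    ultimately show "p \<in> class2 E F CH CO d"
      unfolding class2_quads using c(3) m(3)
      by (intro CollectI exI conjI)
  qed
qed

text \<open>Two polygons sharing an edge at \<open>v\<close> contribute one edge, joining their
  copies of \<open>v\<close>. It is the link of whichever of the two mated corners starts at
  \<open>v\<close>.\<close>

lemma class3_edges:
  "{{copy F d f i v, copy F d f' j v} | f f' i j.
      f \<in> F \<union> CH \<union> CO \<and> f' \<in> F \<union> CH \<union> CO \<and> f \<noteq> f' \<and> i < length f \<and> j < length f' \<and>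
      side f i = side f' j \<and> side f i \<in> E \<and> v \<in> side f i} = hcell {} (at_vertex v)"
  (is "?L = _")
proof
  show "?L \<subseteq> hcell {} (at_vertex v)"
  proof
    fix x assume "x \<in> ?L"
    then obtain f g i j where x: "x = {copy F d f i v, copy F d g j v}"
      and h: "f \<in> polygons" "g \<in> polygons" "f \<noteq> g" "i < length f" "j < length g"
        "side f i = side g j" "v \<in> side f i"
      unfolding polygons_def by blast
    have c: "(f, i) \<in> corners" "(g, j) \<in> corners" "edge (f, i) = edge (g, j)"
      using h by (auto simp: corners_def edge_def)
    have "mate (f, i) = (g, j)"
      using mate_unique[OF c(1) c(2)] c(3) \<open>f \<noteq> g\<close> by simp
    then have m: "mate (f, i) = (g, j)" "mate (g, j) = (f, i)"
      using mate_mate[OF c(1)] by simp_all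
    have pts: "pt (g, j) = pt (succ (f, i))" "pt (succ (g, j)) = pt (f, i)"
      using pt_mate[OF c(1)] m by auto
    have v: "v \<in> edge (f, i)" "v \<in> edge (g, j)" using h by (auto simp: edge_def)
    have copies: "copy F d f i v = (if v = pt (f, i) then hcorner (f, i) else hcorner (succ (f, i)))"
      "copy F d g j v = (if v = pt (g, j) then hcorner (g, j) else hcorner (succ (g, j)))"
      using copy_eq[OF v(1)] copy_eq[OF v(2)] by auto
    show "x \<in> hcell {} (at_vertex v)"
    proof (cases "v = pt (f, i)")
      case True
      then have "x = hlink (f, i)"
        using x copies pts pt_succ_neq[OF c(1)] m by (auto simp: hlink_def)
      then show ?thesis using True c by (auto simp: hcell_def at_vertex_def)
    next
      case False
      then have v: "v = pt (g, j)" using v(1) pts by (auto simp: edge_eq)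
      then have "x = hlink (g, j)" using x copies False m by (auto simp: hlink_def)
      then show ?thesis using v c by (auto simp: hcell_def at_vertex_def)
    qed
  qed
  show "hcell {} (at_vertex v) \<subseteq> ?L"
  proof
    fix x assume "x \<in> hcell {} (at_vertex v)"
    then obtain c where c: "c \<in> corners" "pt c = v" "x = hlink c"
      by (auto simp: hcell_def at_vertex_def)
    let ?m = "mate c"
    have m: "?m \<in> corners" "edge ?m = edge c" "fst c \<noteq> fst ?m" "edge c \<in> E"
      using mate(1,3)[OF c(1)] fst_mate_neq[OF c(1)] edge_in_E[OF c(1)] by simp_all
    have v: "v \<in> edge c" "v \<in> edge ?m" using c m by (auto simp: edge_eq)
    have "pt ?m \<noteq> v" using pt_mate[OF c(1)] pt_succ_neq[OF c(1)] c by simp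
    then have "x = {copy F d (fst c) (snd c) v, copy F d (fst ?m) (snd ?m) v}"
      using copy_eq[OF v(1)] copy_eq[OF v(2)] c by (auto simp: hlink_def)
    moreover have "fst c \<in> F \<union> CH \<union> CO" "fst ?m \<in> F \<union> CH \<union> CO" "snd c < length (fst c)"
      "snd ?m < length (fst ?m)" using c(1) m(1) by (auto simp: corners_def polygons_def)
    moreover have "side (fst c) (snd c) = side (fst ?m) (snd ?m)" "side (fst c) (snd c) \<in> E"
      "v \<in> side (fst c) (snd c)" using m v by (auto simp: edge_def)
    ultimately show "x \<in> ?L" using m(3) by blast
  qed
qed

lemma class3_eq:
  "class3 V E F CH CO d = (\<lambda>v. (hcorner ` at_vertex v, hcell {} (at_vertex v))) ` V"
proof -
  have "{corner (hat F d f) i | f i. f \<in> F \<union> CH \<union> CO \<and> i < length f \<and> f ! i = v} =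
      hcorner ` at_vertex v" for v
    by (force simp: at_vertex_def corners_def polygons_def pt_def hcorner_def)
  then show ?thesis unfolding class3_def class3_edges by auto
qed

section \<open>Counting the cells\<close>

lemma at_edge_nonempty: "e \<in> E \<Longrightarrow> at_edge e \<noteq> {}"
  using edge_image by (auto simp: at_edge_def)

lemma at_vertex_nonempty: "v \<in> V \<Longrightarrow> at_vertex v \<noteq> {}"
  using pt_image by (auto simp: at_vertex_def)

lemma at_polygon_subset: "f \<in> F \<Longrightarrow> {f} \<times> {..<length f} \<subseteq> corners"
  by (auto simp: corners_def polygons_def)

lemma at_polygon_nonempty: "f \<in> F \<Longrightarrow> {f} \<times> {..<length f} \<noteq> {}"
  using F_polygon polygon_length by fastforce

lemma at_edge_subset: "at_edge e \<subseteq> corners"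
  by (auto simp: at_edge_def)

lemma at_vertex_subset: "at_vertex v \<subseteq> corners"
  by (auto simp: at_vertex_def)

lemma UN_at_edge: "(\<Union>e\<in>E. at_edge e) = corners"
  using edge_in_E by (auto simp: at_edge_def)

lemma UN_at_vertex: "(\<Union>v\<in>V. at_vertex v) = corners"
  using pt_in_V by (auto simp: at_vertex_def)

text \<open>The edge set determines the underlying set of corners, and any corner in that nonempty
  set determines the polygon, edge or vertex it came from.\<close>

lemma card_classes:
  shows "card (class1 F d) = card F"
    and "card (class2 E F CH CO d) = card E"
    and "card (class3 V E F CH CO d) = card V"
proof -
  show "card (class1 F d) = card F"
    unfolding class1_eq
  proof (intro card_image inj_onI, elim Pair_inject)
    fix f g assume f: "f \<in> F" and g: "g \<in> F"
      and eq: "hcell ({f} \<times> {..<length f}) {} = hcell ({g} \<times> {..<length g}) {}"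
    have "{f} \<times> {..<length f} = {g} \<times> {..<length g}"
      by (rule hcell_inject(1)[OF at_polygon_subset[OF f] empty_subsetI
            at_polygon_subset[OF g] empty_subsetI eq])
    then show "f = g" using at_polygon_nonempty[OF f] by (auto simp: times_eq_iff)
  qed
  show "card (class2 E F CH CO d) = card E"
    unfolding class2_eq
  proof (intro card_image inj_onI, elim Pair_inject)
    fix e e' assume e: "e \<in> E" and "hcell (at_edge e) (at_edge e) = hcell (at_edge e') (at_edge e')"
    then have "at_edge e = at_edge e'"
      using hcell_inject(1)[OF at_edge_subset at_edge_subset at_edge_subset at_edge_subset] by blast
    then show "e = e'" using at_edge_nonempty[OF e] by (auto simp: at_edge_def)
  qed
  show "card (class3 V E F CH CO d) = card V"
    unfolding class3_eq
  proof (intro card_image inj_onI, elim Pair_inject)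
    fix v v' assume v: "v \<in> V" and "hcell {} (at_vertex v) = hcell {} (at_vertex v')"
    then have "at_vertex v = at_vertex v'"
      using hcell_inject(2)[OF _ at_vertex_subset _ at_vertex_subset] by blast
    then show "v = v'" using at_vertex_nonempty[OF v] by (auto simp: at_vertex_def)
  qed
qed

text \<open>Edge sets suffice: those of class 1 contain no link, those of class 3 no side, and those
  of class 2 contain both kinds.\<close>

lemma classes_disjoint:
  shows "class1 F d \<inter> class2 E F CH CO d = {}"
    and "(class1 F d \<union> class2 E F CH CO d) \<inter> class3 V E F CH CO d = {}"
proof -
  have 12: "hcell ({f} \<times> {..<length f}) {} \<noteq> hcell (at_edge e) (at_edge e)" if "f \<in> F" "e \<in> E" for f e
    using hcell_inject(2)[OF at_polygon_subset[OF that(1)] _ at_edge_subset at_edge_subset]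
      at_edge_nonempty[OF that(2)] by blast
  have 13: "hcell ({f} \<times> {..<length f}) {} \<noteq> hcell {} (at_vertex v)" if "f \<in> F" "v \<in> V" for f v
    using hcell_inject(2)[OF at_polygon_subset[OF that(1)] _ _ at_vertex_subset]
      at_vertex_nonempty[OF that(2)] by blast
  have 23: "hcell (at_edge e) (at_edge e) \<noteq> hcell {} (at_vertex v)" if "e \<in> E" for e v
    using hcell_inject(1)[OF at_edge_subset at_edge_subset _ at_vertex_subset]
      at_edge_nonempty[OF that] by blast
  have disjoint: "X \<inter> Y = {}" if "\<And>p q. p \<in> X \<Longrightarrow> q \<in> Y \<Longrightarrow> snd p \<noteq> snd q" for X Y :: "hplgn set"
    using that by blast
  show "class1 F d \<inter> class2 E F CH CO d = {}"
    unfolding class1_eq class2_eq by (rule disjoint) (auto simp: 12)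
  show "(class1 F d \<union> class2 E F CH CO d) \<inter> class3 V E F CH CO d = {}"
    unfolding class1_eq class2_eq class3_eq by (rule disjoint) (auto simp: 13 23)
qed

lemma card_euler_polygons:
  "card (euler_polygons V E F CH CO d) = card V + card E + card F"
proof -
  have "finite (class1 F d)" "finite (class2 E F CH CO d)" "finite (class3 V E F CH CO d)"
    unfolding class1_eq class2_eq class3_eq using finite_F finite_E finite_V by auto
  then show ?thesis
    unfolding euler_polygons_def
    by (simp add: card_Un_disjoint classes_disjoint card_classes)
qed

lemma UN_hcell: "(\<Union>x\<in>I. hcell (A x) (B x)) = hcell (\<Union>x\<in>I. A x) (\<Union>x\<in>I. B x)"
  by (simp add: hcell_def UN_Un_distrib image_UN)

text \<open>Each corner belongs to the 4-gon of its edge, so class 2 yields every side and link; the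
  edges of the other classes are among these.\<close>

lemma euler_edges_eq: "euler_edges V E F CH CO d = hside ` corners \<union> hlink ` corners"
proof -
  have "euler_edges V E F CH CO d =
      hcell (\<Union>f\<in>F. {f} \<times> {..<length f}) {} \<union> hcell corners corners \<union> hcell {} corners"
    unfolding euler_edges_def euler_polygons_def UN_Un class1_eq class2_eq class3_eq
    by (simp add: image_image UN_hcell UN_at_edge UN_at_vertex)
  moreover have "hside ` (\<Union>f\<in>F. {f} \<times> {..<length f}) \<subseteq> hside ` corners"
    by (intro image_mono UN_least at_polygon_subset)
  ultimately show ?thesis unfolding hcell_def by blast
qed

text \<open>Each corner belongs to the class 3 polygon at its point, and every vertex of the other
  classes is also the copy of a corner.\<close>

lemma euler_verts_eq: "euler_verts V E F CH CO d = hcorner ` corners"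
proof -
  have "(\<Union>f\<in>F. hcorner ` ({f} \<times> {..<length f})) \<subseteq> hcorner ` corners"
    by (intro UN_least image_mono at_polygon_subset)
  moreover have "(\<Union>e\<in>E. hcorner ` (at_edge e \<union> succ ` at_edge e)) \<subseteq> hcorner ` corners"
    by (intro UN_least image_mono) (auto simp: at_edge_def succ_corners)
  moreover have "(\<Union>v\<in>V. hcorner ` at_vertex v) = hcorner ` corners"
    by (simp add: UN_at_vertex flip: image_UN)
  ultimately show ?thesis
    unfolding euler_verts_def euler_polygons_def UN_Un class1_eq class2_eq class3_eq
    by (simp add: image_image Un_absorb1)
qed

lemma card_euler_verts: "card (euler_verts V E F CH CO d) = 2 * card E"
  by (simp add: euler_verts_eq card_image[OF inj_hcorner] card_corners)

lemma card_euler_edges: "card (euler_edges V E F CH CO d) = 4 * card E"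
proof -
  have "hside ` corners \<inter> hlink ` corners = {}" using hside_neq_hlink by blast
  then have "card (euler_edges V E F CH CO d) = card (hside ` corners) + card (hlink ` corners)"
    unfolding euler_edges_eq using finite_corners by (intro card_Un_disjoint) auto
  then show ?thesis by (simp add: card_image[OF inj_hside] card_image[OF inj_hlink] card_corners)
qed

end

theorem lemma3p3:
  fixes V :: "complex set" and E :: "complex set set" and F CH CO :: "plgn set"
    and d :: "plgn \<Rightarrow> real"
  assumes "polygonal_complex V E F"
    and "finite V" "finite E" "finite F"
    and "connected (underlying_space V E F)"
    and "pure_complex V E F"
    and "holes_and_outside V E F CH CO"
    and cond1: "underlying_space V E F \<union> (\<Union>h\<in>CH. region h) \<union> (\<Union>q\<in>CO. region q) = UNIV"
    and cond2: "\<forall>h\<in>CH. \<forall>c\<in>CH \<union> CO. h \<noteq> c \<longrightarrow> region h \<inter> region c = {}"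
    and cond3: "\<forall>f\<in>F. \<forall>h\<in>CH. card (sides f \<inter> sides h) \<le> 1"
    and cond4: "\<forall>f\<in>F. \<forall>q\<in>CO. \<forall>i<length f. \<not> (side f i \<in> sides q \<and> side f (nxt f i) \<in> sides q)"
    and "\<forall>f\<in>F. small_offset (d f) f"
  shows "card (euler_verts V E F CH CO d) = 2 * card E \<and>
         card (euler_edges V E F CH CO d) = 4 * card E \<and>
         card (euler_polygons V E F CH CO d) = card V + card E + card F"
proof -
  interpret euler_complex V E F CH CO d
    by (unfold_locales; fact assms)
  show ?thesis using card_euler_verts card_euler_edges card_euler_polygons by blast
qed

end
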